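(* Let $\mathbb Z[\varepsilon]=\mathbb Z[T]/(T^2)$. The category $\operatorname{G-proj}\mathbb Z[\varepsilon]$ of Gorenstein-projective $\mathbb Z[\varepsilon]$-modules fails to have the Krull-Remak-Schmidt property; that is, the decomposition of an object of $\operatorname{G-proj}\mathbb Z[\varepsilon]$ into a finite direct sum of indecomposable objects is in general not unique up to isomorphism and reordering of the summands.
   Context: All modules are finitely generated right modules. A $\Lambda$-module $M$ is Gorenstein-projective if there is a doubly infinite exact sequence $P^\bullet:\cdots\to P^{-1}\to P^0\xrightarrow{d^0}P^1\to\cdots$ of finitely generated projective $\Lambda$-modules such that $\operatorname{Hom}_\Lambda(P^\bullet,\Lambda)$ is exact and $M\cong\operatorname{Ker}d^0$; $\operatorname{G-proj}\Lambda$ is the full subcategory of $\operatorname{mod}\Lambda$ of such modules. *)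

theory Defs
  imports "HOL-Algebra.IntRing" "HOL-Algebra.UnivPoly"
begin

text \<open>Modules over a commutative ring are those of \<open>HOL-Algebra\<close>; over a commutative ring there is no
  difference between left and right modules.\<close>

definition fin_gen :: "('r, 'x) ring_scheme \<Rightarrow> ('r, 'a) module \<Rightarrow> bool" where
  "fin_gen R M \<longleftrightarrow> (\<exists>S. finite S \<and> S \<subseteq> carrier M \<and>
     (\<forall>H. submodule H R M \<and> S \<subseteq> H \<longrightarrow> H = carrier M))"

text \<open>Homomorphisms are extensional functions, so that equality of homomorphisms is equality of functions.\<close>

definition mod_hom ::
    "('r, 'x) ring_scheme \<Rightarrow> ('r, 'a) module \<Rightarrow> ('r, 'b) module \<Rightarrow> ('a \<Rightarrow> 'b) set" where
  "mod_hom R M N = {f \<in> carrier M \<rightarrow>\<^sub>E carrier N.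
     (\<forall>x\<in>carrier M. \<forall>y\<in>carrier M. f (x \<oplus>\<^bsub>M\<^esub> y) = f x \<oplus>\<^bsub>N\<^esub> f y) \<and>
     (\<forall>r\<in>carrier R. \<forall>x\<in>carrier M. f (r \<odot>\<^bsub>M\<^esub> x) = r \<odot>\<^bsub>N\<^esub> f x)}"

definition mod_iso ::
    "('r, 'x) ring_scheme \<Rightarrow> ('r, 'a) module \<Rightarrow> ('r, 'b) module \<Rightarrow> bool" where
  "mod_iso R M N \<longleftrightarrow> (\<exists>f\<in>mod_hom R M N. bij_betw f (carrier M) (carrier N))"

definition zero_module :: "('r, 'a) module \<Rightarrow> bool" where
  "zero_module M \<longleftrightarrow> carrier M = {\<zero>\<^bsub>M\<^esub>}"

text \<open>Modules are records, whose \<open>mult\<close> and \<open>one\<close> fields play no role.\<close>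

definition direct_sum :: "'i set \<Rightarrow> ('i \<Rightarrow> ('r, 'a) module) \<Rightarrow> ('r, 'i \<Rightarrow> 'a) module" where
  "direct_sum I M = \<lparr>carrier = (\<Pi>\<^sub>E i\<in>I. carrier (M i)),
     mult = (\<lambda>_ _. undefined), one = undefined,
     zero = (\<lambda>i\<in>I. \<zero>\<^bsub>M i\<^esub>),
     add = (\<lambda>f g. \<lambda>i\<in>I. f i \<oplus>\<^bsub>M i\<^esub> g i),
     smult = (\<lambda>r f. \<lambda>i\<in>I. r \<odot>\<^bsub>M i\<^esub> f i)\<rparr>"

definition hom_module ::
    "('r, 'x) ring_scheme \<Rightarrow> ('r, 'a) module \<Rightarrow> ('r, 'b) module \<Rightarrow> ('r, 'a \<Rightarrow> 'b) module" where
  "hom_module R M N = \<lparr>carrier = mod_hom R M N,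
     mult = (\<lambda>_ _. undefined), one = undefined,
     zero = (\<lambda>x\<in>carrier M. \<zero>\<^bsub>N\<^esub>),
     add = (\<lambda>f g. \<lambda>x\<in>carrier M. f x \<oplus>\<^bsub>N\<^esub> g x),
     smult = (\<lambda>r f. \<lambda>x\<in>carrier M. r \<odot>\<^bsub>N\<^esub> f x)\<rparr>"

definition regular_module :: "('r, 'x) ring_scheme \<Rightarrow> ('r, 'r) module" where
  "regular_module R = \<lparr>carrier = carrier R, mult = mult R, one = \<one>\<^bsub>R\<^esub>, zero = \<zero>\<^bsub>R\<^esub>, add = add R,
     smult = mult R\<rparr>"

text \<open>HOL has no type of all modules, so quantification over \<open>mod R\<close> ranges over the modules whose
  carrier is a set of functions \<open>nat \<Rightarrow> 'r\<close>. Up to isomorphism these are all finitely generated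
  modules: see \<open>fin_gen_essentially_small\<close>.\<close>

type_synonym 'r cmodule = "('r, nat \<Rightarrow> 'r) module"

definition fg_modules :: "('r, 'x) ring_scheme \<Rightarrow> 'r cmodule set" where
  "fg_modules R = {M. module R M \<and> fin_gen R M}"

lemma fin_gen_essentially_small:
  fixes M :: "('r, 'a) module"
  assumes M: "module R M" and fg: "fin_gen R M"
  shows "\<exists>N\<in>fg_modules R. mod_iso R M N"
proof -
  interpret M: module R M by (rule M)
  obtain S where S: "finite S" "S \<subseteq> carrier M"
    and gen: "\<And>H. submodule H R M \<Longrightarrow> S \<subseteq> H \<Longrightarrow> H = carrier M"
    using fg unfolding fin_gen_def by blast
  obtain s :: "nat \<Rightarrow> 'a" and n where s: "bij_betw s {..<n} S"
    using ex_bij_betw_nat_finite[OF S(1)] by (auto simp: atLeast0LessThan)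
  have sM: "s i \<in> carrier M" if "i < n" for i
    using s S(2) that by (auto simp: bij_betw_def)
  define A where "A = {..<n} \<rightarrow> carrier R"
  define \<phi> where "\<phi> a = (\<Oplus>\<^bsub>M\<^esub>i\<in>{..<n}. a i \<odot>\<^bsub>M\<^esub> s i)" for a :: "nat \<Rightarrow> 'r"
  have term_closed: "(\<lambda>i. a i \<odot>\<^bsub>M\<^esub> s i) \<in> {..<n} \<rightarrow> carrier M" if "a \<in> A" for a
    using that sM by (auto simp: A_def)
  have \<phi>_closed: "\<phi> a \<in> carrier M" if "a \<in> A" for a
    unfolding \<phi>_def using term_closed[OF that] by (rule M.M.finsum_closed)
  have \<phi>_add: "\<phi> a \<oplus>\<^bsub>M\<^esub> \<phi> b = \<phi> (\<lambda>i. a i \<oplus>\<^bsub>R\<^esub> b i)" if "a \<in> A" "b \<in> A" for a b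
  proof -
    have "\<phi> a \<oplus>\<^bsub>M\<^esub> \<phi> b = (\<Oplus>\<^bsub>M\<^esub>i\<in>{..<n}. a i \<odot>\<^bsub>M\<^esub> s i \<oplus>\<^bsub>M\<^esub> b i \<odot>\<^bsub>M\<^esub> s i)"
      unfolding \<phi>_def using that by (intro M.M.finsum_addf[symmetric] term_closed)
    also have "\<dots> = \<phi> (\<lambda>i. a i \<oplus>\<^bsub>R\<^esub> b i)"
      unfolding \<phi>_def using that sM
      by (intro M.M.finsum_cong') (auto simp: A_def Pi_iff M.smult_l_distr)
    finally show ?thesis .
  qed
  have \<phi>_smult: "r \<odot>\<^bsub>M\<^esub> \<phi> a = \<phi> (\<lambda>i. r \<otimes>\<^bsub>R\<^esub> a i)" if "r \<in> carrier R" "a \<in> A" for r a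
  proof -
    have "r \<odot>\<^bsub>M\<^esub> \<phi> a = (\<Oplus>\<^bsub>M\<^esub>i\<in>{..<n}. r \<odot>\<^bsub>M\<^esub> (a i \<odot>\<^bsub>M\<^esub> s i))"
      unfolding \<phi>_def using that term_closed[OF that(2)]
      by (intro M.finsum_smult_ldistr) auto
    also have "\<dots> = \<phi> (\<lambda>i. r \<otimes>\<^bsub>R\<^esub> a i)"
      unfolding \<phi>_def using that sM
      by (intro M.M.finsum_cong') (auto simp: A_def Pi_iff M.smult_assoc1)
    finally show ?thesis .
  qed
  have sub: "submodule (\<phi> ` A) R M"
  proof (rule M.submoduleI)
    show "\<phi> ` A \<subseteq> carrier M" using \<phi>_closed by auto
    have "\<phi> (\<lambda>_. \<zero>\<^bsub>R\<^esub>) = (\<Oplus>\<^bsub>M\<^esub>i\<in>{..<n}. \<zero>\<^bsub>M\<^esub>)"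
      unfolding \<phi>_def using sM by (intro M.M.finsum_cong') auto
    moreover have "(\<lambda>_. \<zero>\<^bsub>R\<^esub>) \<in> A" by (auto simp: A_def)
    ultimately show "\<zero>\<^bsub>M\<^esub> \<in> \<phi> ` A" by (metis M.M.finsum_zero image_eqI)
  next
    fix x assume "x \<in> \<phi> ` A"
    then obtain a where a: "a \<in> A" "x = \<phi> a" by auto
    have "\<ominus>\<^bsub>M\<^esub> x = (\<ominus>\<^bsub>R\<^esub> \<one>\<^bsub>R\<^esub>) \<odot>\<^bsub>M\<^esub> x"
      using a \<phi>_closed by (simp add: M.smult_l_minus)
    also have "\<dots> = \<phi> (\<lambda>i. (\<ominus>\<^bsub>R\<^esub> \<one>\<^bsub>R\<^esub>) \<otimes>\<^bsub>R\<^esub> a i)"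
      using a by (simp add: \<phi>_smult)
    finally show "\<ominus>\<^bsub>M\<^esub> x \<in> \<phi> ` A" using a by (auto simp: A_def Pi_iff)
  next
    fix x y assume "x \<in> \<phi> ` A" "y \<in> \<phi> ` A"
    then obtain a b where "a \<in> A" "b \<in> A" "x = \<phi> a" "y = \<phi> b" by auto
    then show "x \<oplus>\<^bsub>M\<^esub> y \<in> \<phi> ` A" by (auto simp: \<phi>_add A_def Pi_iff)
  next
    fix r x assume "r \<in> carrier R" "x \<in> \<phi> ` A"
    then obtain a where "a \<in> A" "x = \<phi> a" by auto
    with \<open>r \<in> carrier R\<close> show "r \<odot>\<^bsub>M\<^esub> x \<in> \<phi> ` A" by (auto simp: \<phi>_smult A_def Pi_iff)
  qed
  have "S \<subseteq> \<phi> ` A"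
  proof
    fix x assume "x \<in> S"
    then obtain j where j: "j < n" "x = s j" using s by (auto simp: bij_betw_def)
    have "\<phi> (\<lambda>i. if i = j then \<one>\<^bsub>R\<^esub> else \<zero>\<^bsub>R\<^esub>) = (\<Oplus>\<^bsub>M\<^esub>i\<in>{..<n}. if j = i then s i else \<zero>\<^bsub>M\<^esub>)"
      unfolding \<phi>_def using sM by (intro M.M.finsum_cong') auto
    also have "\<dots> = x" using j sM by (subst M.M.finsum_singleton) auto
    finally show "x \<in> \<phi> ` A" by (auto simp: A_def image_iff intro!: bexI)
  qed
  then have onto: "\<phi> ` A = carrier M" using gen[OF sub] by simp
  define \<sigma> where "\<sigma> = inv_into A \<phi>"
  have \<phi>\<sigma>: "\<phi> (\<sigma> x) = x" if "x \<in> carrier M" for x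
    unfolding \<sigma>_def using that onto by (simp add: f_inv_into_f)
  define N :: "'r cmodule" where "N = \<lparr>carrier = \<sigma> ` carrier M,
     mult = (\<lambda>_ _. undefined), one = undefined, zero = \<sigma> \<zero>\<^bsub>M\<^esub>,
     add = (\<lambda>a b. \<sigma> (\<phi> a \<oplus>\<^bsub>M\<^esub> \<phi> b)), smult = (\<lambda>r a. \<sigma> (r \<odot>\<^bsub>M\<^esub> \<phi> a))\<rparr>"
  have N_simps: "carrier N = \<sigma> ` carrier M" "\<zero>\<^bsub>N\<^esub> = \<sigma> \<zero>\<^bsub>M\<^esub>"
    "a \<oplus>\<^bsub>N\<^esub> b = \<sigma> (\<phi> a \<oplus>\<^bsub>M\<^esub> \<phi> b)" "r \<odot>\<^bsub>N\<^esub> a = \<sigma> (r \<odot>\<^bsub>M\<^esub> \<phi> a)" for a b r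
    by (simp_all add: N_def)
  have N: "module R N"
  proof (rule moduleI)
    show "cring R" by (rule M.R.cring_axioms)
    show "abelian_group N"
    proof (rule abelian_groupI)
      fix x assume "x \<in> carrier N"
      then obtain m where m: "m \<in> carrier M" "x = \<sigma> m" by (auto simp: N_simps)
      then have "\<sigma> (\<ominus>\<^bsub>M\<^esub> m) \<in> carrier N" "\<sigma> (\<ominus>\<^bsub>M\<^esub> m) \<oplus>\<^bsub>N\<^esub> x = \<zero>\<^bsub>N\<^esub>"
        by (auto simp: N_simps \<phi>\<sigma> M.M.l_neg)
      then show "\<exists>y\<in>carrier N. y \<oplus>\<^bsub>N\<^esub> x = \<zero>\<^bsub>N\<^esub>" by blast
    qed (auto simp: N_simps \<phi>\<sigma> M.M.a_ac)
  qed (auto simp: N_simps \<phi>\<sigma> M.smult_l_distr M.smult_r_distr M.smult_assoc1)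
  interpret N: module R N by (rule N)
  have "fin_gen R N"
    unfolding fin_gen_def
  proof (intro exI[of _ "\<sigma> ` S"] conjI allI impI)
    fix H assume H: "submodule H R N \<and> \<sigma> ` S \<subseteq> H"
    note HE = N.submoduleE[OF conjunct1[OF H]]
    define K where "K = {x \<in> carrier M. \<sigma> x \<in> H}"
    have "submodule K R M"
    proof (rule M.submoduleI)
      obtain y where "y \<in> H" using HE(2) by blast
      then have "\<zero>\<^bsub>R\<^esub> \<odot>\<^bsub>N\<^esub> y \<in> H" "y \<in> carrier N" using HE(1,4) by auto
      then have "\<zero>\<^bsub>N\<^esub> \<in> H" by simp
      then show "\<zero>\<^bsub>M\<^esub> \<in> K" by (simp add: K_def N_simps)
    next
      fix x assume x: "x \<in> K"
      then have "(\<ominus>\<^bsub>R\<^esub> \<one>\<^bsub>R\<^esub>) \<odot>\<^bsub>N\<^esub> \<sigma> x \<in> H" using HE(4) by (simp add: K_def)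
      then show "\<ominus>\<^bsub>M\<^esub> x \<in> K" using x by (simp add: K_def N_simps \<phi>\<sigma> M.smult_l_minus)
    next
      fix x y assume xy: "x \<in> K" "y \<in> K"
      then have "\<sigma> x \<oplus>\<^bsub>N\<^esub> \<sigma> y \<in> H" using HE(5) by (simp add: K_def)
      then show "x \<oplus>\<^bsub>M\<^esub> y \<in> K" using xy by (simp add: K_def N_simps \<phi>\<sigma>)
    next
      fix r x assume rx: "r \<in> carrier R" "x \<in> K"
      then have "r \<odot>\<^bsub>N\<^esub> \<sigma> x \<in> H" using HE(4) by (simp add: K_def)
      then show "r \<odot>\<^bsub>M\<^esub> x \<in> K" using rx by (simp add: K_def N_simps \<phi>\<sigma>)
    qed (auto simp: K_def)
    moreover have "S \<subseteq> K" using H S(2) by (auto simp: K_def)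
    ultimately have "K = carrier M" by (rule gen)
    then show "H = carrier N" using HE(1) by (auto simp: K_def N_simps)
  qed (use S in \<open>auto simp: N_simps\<close>)
  with N have "N \<in> fg_modules R" by (simp add: fg_modules_def)
  moreover have "mod_iso R M N"
    unfolding mod_iso_def
  proof (rule bexI[of _ "restrict \<sigma> (carrier M)"])
    have "inj_on \<sigma> (carrier M)" by (metis \<phi>\<sigma> inj_onI)
    then show "bij_betw (restrict \<sigma> (carrier M)) (carrier M) (carrier N)"
      by (simp add: bij_betw_def N_simps inj_on_restrict_eq)
    show "restrict \<sigma> (carrier M) \<in> mod_hom R M N"
      by (auto simp: mod_hom_def N_simps \<phi>\<sigma>)
  qed
  ultimately show ?thesis by blast
qed

definition fg_projective :: "('r, 'x) ring_scheme \<Rightarrow> 'r cmodule set" where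
  "fg_projective R = {P \<in> fg_modules R.
     \<forall>X\<in>fg_modules R. \<forall>Y\<in>fg_modules R. \<forall>g\<in>mod_hom R X Y. \<forall>f\<in>mod_hom R P Y.
       g ` carrier X = carrier Y \<longrightarrow> (\<exists>h\<in>mod_hom R P X. compose (carrier P) g h = f)}"

text \<open>A complex has differentials \<open>d i : C i \<rightarrow> C (i + 1)\<close>.\<close>

definition exact_complex ::
    "('r, 'x) ring_scheme \<Rightarrow> (int \<Rightarrow> ('r, 'a) module) \<Rightarrow> (int \<Rightarrow> 'a \<Rightarrow> 'a) \<Rightarrow> bool" where
  "exact_complex R C d \<longleftrightarrow>
     (\<forall>i. d i \<in> mod_hom R (C i) (C (i + 1))) \<and>
     (\<forall>i. d (i - 1) ` carrier (C (i - 1)) = a_kernel (C i) (C (i + 1)) (d i))"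

text \<open>\<open>Hom(-, R)\<close> reverses the arrows, so the dual of \<open>P\<close> has \<open>Hom(P (-i), R)\<close> in degree \<open>i\<close> and its
  differential in degree \<open>i\<close> is composition with \<open>d (-i - 1) : P (-i - 1) \<rightarrow> P (-i)\<close>.\<close>

definition dual_complex ::
    "('r, 'x) ring_scheme \<Rightarrow> (int \<Rightarrow> ('r, 'a) module) \<Rightarrow> int \<Rightarrow> ('r, 'a \<Rightarrow> 'r) module" where
  "dual_complex R P i = hom_module R (P (- i)) (regular_module R)"

definition dual_differential ::
    "('r, 'x) ring_scheme \<Rightarrow> (int \<Rightarrow> ('r, 'a) module) \<Rightarrow> (int \<Rightarrow> 'a \<Rightarrow> 'a) \<Rightarrow>
      int \<Rightarrow> ('a \<Rightarrow> 'r) \<Rightarrow> ('a \<Rightarrow> 'r)" where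
  "dual_differential R P d i =
     (\<lambda>g\<in>carrier (dual_complex R P i). compose (carrier (P (- i - 1))) g (d (- i - 1)))"

definition gorenstein_projective :: "('r, 'x) ring_scheme \<Rightarrow> 'r cmodule \<Rightarrow> bool" where
  "gorenstein_projective R M \<longleftrightarrow> (\<exists>P d.
     (\<forall>i. P i \<in> fg_projective R) \<and>
     exact_complex R P d \<and>
     exact_complex R (dual_complex R P) (dual_differential R P d) \<and>
     mod_iso R M ((P 0)\<lparr>carrier := a_kernel (P 0) (P 1) (d 0)\<rparr>))"

definition G_proj :: "('r, 'x) ring_scheme \<Rightarrow> 'r cmodule set" where
  "G_proj R = {M \<in> fg_modules R. gorenstein_projective R M}"

text \<open>\<open>C\<close> is a class of modules (a full subcategory) closed under isomorphism.\<close>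

definition indecomposable_in :: "('r, 'x) ring_scheme \<Rightarrow> 'r cmodule set \<Rightarrow> 'r cmodule \<Rightarrow> bool" where
  "indecomposable_in R C M \<longleftrightarrow> M \<in> C \<and> \<not> zero_module M \<and>
     (\<forall>X. X 0 \<in> C \<and> X 1 \<in> C \<and> mod_iso R M (direct_sum {0, 1 :: nat} X) \<longrightarrow>
        zero_module (X 0) \<or> zero_module (X 1))"

abbreviation int_poly_ring :: "(int, nat \<Rightarrow> int) up_ring" where
  "int_poly_ring \<equiv> UP \<Z>"

text \<open>\<open>monom P 1 1\<close> is the indeterminate \<open>T\<close>.\<close>

definition int_dual_numbers :: "(nat \<Rightarrow> int) set ring" where
  "int_dual_numbers = int_poly_ring Quot
     (PIdl\<^bsub>int_poly_ring\<^esub> (monom int_poly_ring 1 1 [^]\<^bsub>int_poly_ring\<^esub> (2 :: nat)))"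

lemma int_dual_numbers_cring: "cring int_dual_numbers"
proof -
  interpret UP_cring \<Z> int_poly_ring
    by (simp add: UP_cring_def int.is_cring)
  show ?thesis
    unfolding int_dual_numbers_def
    by (intro ideal.quotient_is_cring P.cgenideal_ideal UP_cring) simp
qed

end

theory Submission
  imports Defs
begin

text \<open>A lattice over \<open>\<int>[\<epsilon>]\<close> is a free abelian group of finite rank with an endomorphism
  \<open>\<epsilon>\<close> of square zero. Write \<open>L\<^sub>n\<close> for \<open>\<int>\<^sup>2\<close> with \<open>\<epsilon>(a, b) = (n b, 0)\<close>. The matrices
  \<open>[[\<epsilon>, -N], [0, \<epsilon>]]\<close> and \<open>[[\<epsilon>, N], [0, \<epsilon>]]\<close>, with \<open>N\<close> a diagonal integer matrix, form a matrix
  factorization of \<open>T\<^sup>2\<close>; the resulting 2-periodic complex of free modules and its dual are exact,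
  and its kernels are the sums of the \<open>L\<^sub>n\<close>, which are therefore Gorenstein-projective. For \<open>n \<noteq> 0\<close> any two nonzero
  submodules of \<open>L\<^sub>n\<close> meet in the line \<open>b = 0\<close>, so \<open>L\<^sub>n\<close> is indecomposable. Since \<open>diag(1, 6)\<close>
  and \<open>diag(2, 3)\<close> have the same Smith normal form, \<open>L\<^sub>1 \<oplus> L\<^sub>6 \<cong> L\<^sub>2 \<oplus> L\<^sub>3\<close>; but \<open>L\<^sub>1\<close> is not
  isomorphic to \<open>L\<^sub>2\<close> or \<open>L\<^sub>3\<close>, as \<open>ker \<epsilon> = im \<epsilon>\<close> holds in \<open>L\<^sub>n\<close> only for \<open>n = \<plusminus>1\<close>.\<close>

section \<open>Coordinates on the dual numbers\<close>

context
begin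

private abbreviation (input) "P \<equiv> int_poly_ring"

interpretation UP_cring \<Z> int_poly_ring
  by (simp add: UP_cring_def int.is_cring)

private definition T2 :: "(nat \<Rightarrow> int) set" where
  "T2 = PIdl\<^bsub>P\<^esub> (monom P 1 2)"

private lemma T2_ideal: "ideal T2 P"
  unfolding T2_def by (intro P.cgenideal_ideal) simp

private lemma int_dual_numbers_eq: "int_dual_numbers = P Quot T2"
  using monom_one_Suc[of 1] by (simp add: int_dual_numbers_def T2_def numeral_2_eq_2)

definition dual_num :: "int \<Rightarrow> int \<Rightarrow> (nat \<Rightarrow> int) set" where
  "dual_num a b = T2 +>\<^bsub>P\<^esub> (monom P a 0 \<oplus>\<^bsub>P\<^esub> monom P b 1)"

text \<open>Multiplication by T^2 shifts coefficients up by two, so its multiples lose the two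
  lowest ones. Conversely, a polynomial without these two is T^2 times its downward shift.\<close>

private lemma mem_T2_iff:
  assumes p: "p \<in> carrier P"
  shows "p \<in> T2 \<longleftrightarrow> coeff P p 0 = 0 \<and> coeff P p 1 = 0"
proof -
  have shift: "coeff P (q \<otimes>\<^bsub>P\<^esub> monom P 1 2) n = (if n < 2 then 0 else coeff P q (n - 2))"
    if q: "q \<in> carrier P" for q n
  proof -
    have "coeff P (q \<otimes>\<^bsub>P\<^esub> monom P 1 2) n = (\<Sum>i\<le>n. coeff P q i * (if 2 = n - i then 1 else 0))"
      using q by (simp add: int_finsum_eq)
    \<comment> \<open>At most one term of the convolution survives. The guard
      \<open>2 \<le> n\<close> is there because subtraction on \<open>nat\<close> truncates.\<close>
    also have "\<dots> = (\<Sum>i\<le>n. if i = n - 2 \<and> 2 \<le> n then coeff P q i else 0)"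
      by (intro sum.cong) auto
    also have "\<dots> = (if n < 2 then 0 else coeff P q (n - 2))"
      by (cases "n < 2") auto
    finally show ?thesis .
  qed
  show ?thesis
  proof
    assume "p \<in> T2"
    then show "coeff P p 0 = 0 \<and> coeff P p 1 = 0"
      by (auto simp: T2_def cgenideal_def shift simp del: coeff_mult)
  next
    assume z: "coeff P p 0 = 0 \<and> coeff P p 1 = 0"
    \<comment> \<open>The quotient of \<open>p\<close> by T^2. Elements of \<open>UP \<Z>\<close>
      are their own coefficient functions, and a bound for \<open>p\<close> is also one for
      \<open>q\<close>.\<close>
    define q where "q = (\<lambda>n. coeff P p (n + 2))"
    have up: "p \<in> up \<Z>" using p by (simp add: UP_def)
    then obtain N where "bound \<zero>\<^bsub>\<Z>\<^esub> N p" by (auto simp: up_def)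
    then have "bound \<zero>\<^bsub>\<Z>\<^esub> N q" using up by (auto simp: bound_def q_def UP_def)
    then have q: "q \<in> carrier P" "coeff P q = q" by (auto simp: UP_def intro!: mem_upI exI[of _ N])
    have "p = q \<otimes>\<^bsub>P\<^esub> monom P 1 2"
    proof (rule up_eqI)
      fix n
      have "n = 0 \<or> n = 1 \<or> (\<exists>m :: nat. n = m + 2)" by presburger
      then have "coeff P p n = (if n < 2 then 0 else coeff P q (n - 2))"
        using z q(2) by (auto simp: q_def)
      then show "coeff P p n = coeff P (q \<otimes>\<^bsub>P\<^esub> monom P 1 2) n" using shift[OF q(1)] by simp
    qed (use p q in simp_all)
    then show "p \<in> T2" using q by (auto simp: T2_def cgenideal_def)
  qed
qed

private lemma coset_eq_iff:
  assumes "p \<in> carrier P" "q \<in> carrier P"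
  shows "T2 +>\<^bsub>P\<^esub> p = T2 +>\<^bsub>P\<^esub> q \<longleftrightarrow> coeff P p 0 = coeff P q 0 \<and> coeff P p 1 = coeff P q 1"
proof -
  have "T2 +>\<^bsub>P\<^esub> p = T2 +>\<^bsub>P\<^esub> q \<longleftrightarrow> p \<ominus>\<^bsub>P\<^esub> q \<in> T2"
    using P.quotient_eq_iff_same_a_r_cos[OF T2_ideal] assms by simp
  also have "\<dots> \<longleftrightarrow> coeff P p 0 = coeff P q 0 \<and> coeff P p 1 = coeff P q 1"
    using assms by (subst mem_T2_iff) (simp_all add: a_minus_def int_a_inv_eq)
  finally show ?thesis .
qed

text \<open>Ring operations are carried out on polynomial representatives; this brings the result
  back to the form a + b\<epsilon>.\<close>

private lemma coset_conv_dual_num: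
  assumes "p \<in> carrier P"
  shows "T2 +>\<^bsub>P\<^esub> p = dual_num (coeff P p 0) (coeff P p 1)"
  unfolding dual_num_def using assms by (subst coset_eq_iff) simp_all

lemma dual_num_inject [simp]: "dual_num a b = dual_num c d \<longleftrightarrow> a = c \<and> b = d"
  unfolding dual_num_def by (subst coset_eq_iff) simp_all

lemma carrier_int_dual_numbers: "carrier int_dual_numbers = range (\<lambda>(a, b). dual_num a b)"
proof
  show "carrier int_dual_numbers \<subseteq> range (\<lambda>(a, b). dual_num a b)"
    by (auto simp: int_dual_numbers_eq FactRing_def A_RCOSETS_def' coset_conv_dual_num)
  show "range (\<lambda>(a, b). dual_num a b) \<subseteq> carrier int_dual_numbers"
    by (auto simp: int_dual_numbers_eq FactRing_def A_RCOSETS_def' dual_num_def intro!: bexI[OF _ UP_a_closed])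
qed

lemma dual_num_zero: "\<zero>\<^bsub>int_dual_numbers\<^esub> = dual_num 0 0"
proof -
  \<comment> \<open>The zero of the quotient ring is the ideal itself and first has to be seen as
    the coset of 0.\<close>
  have "\<zero>\<^bsub>int_dual_numbers\<^esub> = T2 +>\<^bsub>P\<^esub> \<zero>\<^bsub>P\<^esub>"
    using ideal.axioms(1)[OF T2_ideal, THEN additive_subgroup.a_subset]
    by (simp add: int_dual_numbers_eq FactRing_def P.a_coset_add_zero)
  then show ?thesis by (simp add: coset_conv_dual_num)
qed

lemma dual_num_one: "\<one>\<^bsub>int_dual_numbers\<^esub> = dual_num 1 0"
  by (simp add: int_dual_numbers_eq FactRing_def coset_conv_dual_num)

lemma dual_num_add:
  "dual_num a b \<oplus>\<^bsub>int_dual_numbers\<^esub> dual_num c d = dual_num (a + c) (b + d)"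
proof -
  interpret I: ideal T2 P by (rule T2_ideal)
  show ?thesis
    by (simp add: int_dual_numbers_eq FactRing_def dual_num_def I.a_rcos_sum)
      (simp add: coset_eq_iff)
qed

lemma dual_num_mult:
  "dual_num a b \<otimes>\<^bsub>int_dual_numbers\<^esub> dual_num c d = dual_num (a * c) (a * d + b * c)"
proof -
  interpret I: ideal T2 P by (rule T2_ideal)
  show ?thesis
    by (simp add: int_dual_numbers_eq FactRing_def dual_num_def I.rcoset_mult_add)
      (simp add: coset_eq_iff int_finsum_eq)
qed

end

text \<open>By \<open>dual_num_inject\<close> the description is unique on the carrier. Elsewhere
  the value is unspecified, hence the membership hypotheses in the rules for sums and
  products.\<close>

definition re :: "(nat \<Rightarrow> int) set \<Rightarrow> int" where
  "re x = (THE a. \<exists>b. x = dual_num a b)"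

definition im :: "(nat \<Rightarrow> int) set \<Rightarrow> int" where
  "im x = (THE b. \<exists>a. x = dual_num a b)"

lemma re_im_dual_num [simp]: "re (dual_num a b) = a" "im (dual_num a b) = b"
  by (auto simp: re_def im_def)

lemma dual_num_closed [simp]: "dual_num a b \<in> carrier int_dual_numbers"
  by (auto simp: carrier_int_dual_numbers)

lemma dual_num_cases:
  assumes "x \<in> carrier int_dual_numbers"
  obtains a b where "x = dual_num a b"
  using assms by (auto simp: carrier_int_dual_numbers)

interpretation dual: cring int_dual_numbers
  by (rule int_dual_numbers_cring)

lemma re_im_zero [simp]: "re \<zero>\<^bsub>int_dual_numbers\<^esub> = 0" "im \<zero>\<^bsub>int_dual_numbers\<^esub> = 0"
  by (simp_all add: dual_num_zero)

lemma re_im_one [simp]: "re \<one>\<^bsub>int_dual_numbers\<^esub> = 1" "im \<one>\<^bsub>int_dual_numbers\<^esub> = 0"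
  by (simp_all add: dual_num_one)

lemma re_im_add [simp]:
  assumes "x \<in> carrier int_dual_numbers" "y \<in> carrier int_dual_numbers"
  shows "re (x \<oplus>\<^bsub>int_dual_numbers\<^esub> y) = re x + re y"
    and "im (x \<oplus>\<^bsub>int_dual_numbers\<^esub> y) = im x + im y"
  using assms by (auto elim!: dual_num_cases simp: dual_num_add)

lemma re_im_mult [simp]:
  assumes "x \<in> carrier int_dual_numbers" "y \<in> carrier int_dual_numbers"
  shows "re (x \<otimes>\<^bsub>int_dual_numbers\<^esub> y) = re x * re y"
    and "im (x \<otimes>\<^bsub>int_dual_numbers\<^esub> y) = re x * im y + im x * re y"
  using assms by (auto elim!: dual_num_cases simp: dual_num_mult)

lemma dual_eq_iff:
  assumes "x \<in> carrier int_dual_numbers" "y \<in> carrier int_dual_numbers"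
  shows "x = y \<longleftrightarrow> re x = re y \<and> im x = im y"
  using assms by (auto elim!: dual_num_cases)

section \<open>Modules and free modules\<close>

lemma mod_homI:
  assumes "f \<in> extensional (carrier M)"
    and "\<And>x. x \<in> carrier M \<Longrightarrow> f x \<in> carrier N"
    and "\<And>x y. x \<in> carrier M \<Longrightarrow> y \<in> carrier M \<Longrightarrow> f (x \<oplus>\<^bsub>M\<^esub> y) = f x \<oplus>\<^bsub>N\<^esub> f y"
    and "\<And>r x. r \<in> carrier R \<Longrightarrow> x \<in> carrier M \<Longrightarrow> f (r \<odot>\<^bsub>M\<^esub> x) = r \<odot>\<^bsub>N\<^esub> f x"
  shows "f \<in> mod_hom R M N"
  using assms by (auto simp: mod_hom_def PiE_def)

lemma mod_homD:
  assumes "f \<in> mod_hom R M N"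
  shows mod_hom_extensional: "f \<in> extensional (carrier M)"
    and mod_hom_closed: "x \<in> carrier M \<Longrightarrow> f x \<in> carrier N"
    and mod_hom_add: "x \<in> carrier M \<Longrightarrow> y \<in> carrier M \<Longrightarrow> f (x \<oplus>\<^bsub>M\<^esub> y) = f x \<oplus>\<^bsub>N\<^esub> f y"
    and mod_hom_smult: "r \<in> carrier R \<Longrightarrow> x \<in> carrier M \<Longrightarrow> f (r \<odot>\<^bsub>M\<^esub> x) = r \<odot>\<^bsub>N\<^esub> f x"
  using assms by (auto simp: mod_hom_def PiE_def)

lemma mod_hom_zero:
  assumes "module R M" "module R N" "f \<in> mod_hom R M N"
  shows "f \<zero>\<^bsub>M\<^esub> = \<zero>\<^bsub>N\<^esub>"
proof -
  interpret M: module R M by fact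
  interpret N: module R N by fact
  have "f \<zero>\<^bsub>M\<^esub> = f (\<zero>\<^bsub>R\<^esub> \<odot>\<^bsub>M\<^esub> \<zero>\<^bsub>M\<^esub>)" by simp
  also have "\<dots> = \<zero>\<^bsub>R\<^esub> \<odot>\<^bsub>N\<^esub> f \<zero>\<^bsub>M\<^esub>" by (rule mod_hom_smult[OF assms(3)]) auto
  also have "\<dots> = \<zero>\<^bsub>N\<^esub>" using mod_hom_closed[OF assms(3)] by simp
  finally show ?thesis .
qed

lemma mod_hom_compose:
  assumes "module R L" "f \<in> mod_hom R L M" "g \<in> mod_hom R M N"
  shows "compose (carrier L) g f \<in> mod_hom R L N"
proof -
  interpret L: module R L by fact
  show ?thesis
    using assms(2,3) by (intro mod_homI) (auto simp: compose_def mod_homD)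
qed

lemma mod_isoI:
  assumes "f \<in> mod_hom R M N"
    and "\<And>y. y \<in> carrier N \<Longrightarrow> g y \<in> carrier M"
    and "\<And>x. x \<in> carrier M \<Longrightarrow> g (f x) = x" "\<And>y. y \<in> carrier N \<Longrightarrow> f (g y) = y"
  shows "mod_iso R M N"
  unfolding mod_iso_def using assms mod_hom_closed[OF assms(1)]
  by (intro bexI[of _ f] bij_betw_byWitness[where f' = g]) auto

lemma mod_iso_refl:
  assumes "module R M"
  shows "mod_iso R M M"
proof -
  interpret module R M by fact
  show ?thesis
    by (rule mod_isoI[where f = "\<lambda>x\<in>carrier M. x" and g = id]) (auto intro!: mod_homI)
qed

lemma mod_iso_trans:
  assumes "module R L" "mod_iso R L M" "mod_iso R M N"
  shows "mod_iso R L N"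
proof -
  from assms(2,3) obtain f g where
    f: "f \<in> mod_hom R L M" "bij_betw f (carrier L) (carrier M)" and
    g: "g \<in> mod_hom R M N" "bij_betw g (carrier M) (carrier N)"
    unfolding mod_iso_def by blast
  have "bij_betw (compose (carrier L) g f) (carrier L) (carrier N)"
    using bij_betw_trans[OF f(2) g(2)] by (simp add: compose_def cong: bij_betw_cong)
  then show ?thesis
    unfolding mod_iso_def using mod_hom_compose[OF assms(1) f(1) g(1)] by blast
qed

section \<open>Submodules, images, kernels and finite generation\<close>

lemma (in module) submoduleI':
  assumes "H \<subseteq> carrier M" "\<zero>\<^bsub>M\<^esub> \<in> H"
    and "\<And>x y. x \<in> H \<Longrightarrow> y \<in> H \<Longrightarrow> x \<oplus>\<^bsub>M\<^esub> y \<in> H"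
    and "\<And>r x. r \<in> carrier R \<Longrightarrow> x \<in> H \<Longrightarrow> r \<odot>\<^bsub>M\<^esub> x \<in> H"
  shows "submodule H R M"
proof (rule submoduleI)
  fix x assume x: "x \<in> H"
  \<comment> \<open>Negation is multiplication by the scalar -1, so closure under scalars covers
    it.\<close>
  then have "\<ominus>\<^bsub>M\<^esub> x = (\<ominus>\<^bsub>R\<^esub> \<one>\<^bsub>R\<^esub>) \<odot>\<^bsub>M\<^esub> x"
    using assms(1) by (auto simp: smult_l_minus)
  also have "\<dots> \<in> H" using x by (intro assms(4)) auto
  finally show "\<ominus>\<^bsub>M\<^esub> x \<in> H" .
qed (use assms in auto)

lemma (in module) submodule_zero:
  assumes "submodule H R M"
  shows "\<zero>\<^bsub>M\<^esub> \<in> H"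
proof -
  interpret H: submodule H R M by fact
  show ?thesis using H.one_closed by simp
qed

text \<open>This is what makes homomorphisms that agree on generators equal.\<close>

lemma submodule_equalizer:
  assumes "module R M" "module R N" "f \<in> mod_hom R M N" "g \<in> mod_hom R M N"
  shows "submodule {x \<in> carrier M. f x = g x} R M"
proof -
  interpret M: module R M by fact
  show ?thesis
    using assms by (intro M.submoduleI') (auto simp: mod_hom_zero mod_homD)
qed

lemma submodule_image:
  assumes "module R M" "module R N" "f \<in> mod_hom R M N"
  shows "submodule (f ` carrier M) R N"
proof -
  interpret M: module R M by fact
  interpret N: module R N by fact
  show ?thesis
  proof (rule N.submoduleI')
    show "\<zero>\<^bsub>N\<^esub> \<in> f ` carrier M" using mod_hom_zero[OF assms] by (metis M.zero_closed imageI)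
  qed (use assms(3) in \<open>auto simp: mod_homD simp flip: mod_hom_add mod_hom_smult\<close>)
qed

text \<open>The preimage of a submodule containing the images of the generators is a submodule
  containing the generators, hence everything. Kernels of \<open>dmap\<close> will be finitely
  generated because they are images.\<close>

lemma fin_gen_image:
  assumes "module R M" "module R N" "f \<in> mod_hom R M N" "fin_gen R M"
  shows "fin_gen R (N\<lparr>carrier := f ` carrier M\<rparr>)"
proof -
  interpret M: module R M by fact
  interpret N: module R N by fact
  let ?N = "N\<lparr>carrier := f ` carrier M\<rparr>"
  interpret N': module R ?N
    using submodule.submodule_is_module[OF submodule_image[OF assms(1-3)] assms(2)] .
  obtain S where S: "finite S" "S \<subseteq> carrier M"
    and gen: "\<And>H. submodule H R M \<Longrightarrow> S \<subseteq> H \<Longrightarrow> H = carrier M"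
    using assms(4) unfolding fin_gen_def by blast
  show ?thesis
    unfolding fin_gen_def
  proof (intro exI[of _ "f ` S"] conjI allI impI)
    fix H assume H: "submodule H R ?N \<and> f ` S \<subseteq> H"
    note HE = N'.submoduleE[OF conjunct1[OF H]] N'.submodule_zero[OF conjunct1[OF H]]
    have "submodule {x \<in> carrier M. f x \<in> H} R M"
      using assms HE by (intro M.submoduleI') (auto simp: mod_hom_zero mod_homD)
    moreover have "S \<subseteq> {x \<in> carrier M. f x \<in> H}" using S H by auto
    ultimately have "{x \<in> carrier M. f x \<in> H} = carrier M" by (rule gen)
    then show "H = carrier ?N" using HE(1) by auto
  qed (use S in auto)
qed

lemma module_kernel:
  assumes "module R M" "module R N" "f \<in> mod_hom R M N"
  shows "module R (M\<lparr>carrier := a_kernel M N f\<rparr>)"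
proof -
  interpret M: module R M by fact
  interpret N: module R N by fact
  have "submodule (a_kernel M N f) R M"
    using assms by (intro M.submoduleI') (auto simp: a_kernel_def' mod_hom_zero mod_homD)
  then show ?thesis using assms(1) by (rule submodule.submodule_is_module)
qed

section \<open>The regular module and direct sums\<close>

lemma regular_module_simps [simp]:
  "carrier (regular_module R) = carrier R" "\<zero>\<^bsub>regular_module R\<^esub> = \<zero>\<^bsub>R\<^esub>"
  "add (regular_module R) = add R" "smult (regular_module R) = mult R"
  by (simp_all add: regular_module_def)

lemma direct_sum_simps [simp]:
  "carrier (direct_sum I M) = (\<Pi>\<^sub>E i\<in>I. carrier (M i))"
  "\<zero>\<^bsub>direct_sum I M\<^esub> = (\<lambda>i\<in>I. \<zero>\<^bsub>M i\<^esub>)"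
  "f \<oplus>\<^bsub>direct_sum I M\<^esub> g = (\<lambda>i\<in>I. f i \<oplus>\<^bsub>M i\<^esub> g i)"
  "r \<odot>\<^bsub>direct_sum I M\<^esub> f = (\<lambda>i\<in>I. r \<odot>\<^bsub>M i\<^esub> f i)"
  by (simp_all add: direct_sum_def)

lemma module_regular_module:
  assumes "cring R"
  shows "module R (regular_module R)"
proof -
  interpret cring R by fact
  show ?thesis
    by (intro moduleI abelian_groupI assms) (auto simp: a_ac l_distr r_distr m_assoc intro: l_neg)
qed

lemma module_direct_sum:
  assumes "cring R" and M: "\<And>i. i \<in> I \<Longrightarrow> module R (M i)"
  shows "module R (direct_sum I M)"
proof -
  note group = M[THEN module.axioms(2)]
  note monoid = group[THEN abelian_group.axioms(1)]
  have mem: "x i \<in> carrier (M i)" if "x \<in> (\<Pi>\<^sub>E i\<in>I. carrier (M i))" "i \<in> I" for x i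
    using that by (rule PiE_mem)
  show ?thesis
  proof (intro moduleI abelian_groupI assms(1))
    fix x assume x: "x \<in> carrier (direct_sum I M)"
    have "(\<lambda>i\<in>I. \<ominus>\<^bsub>M i\<^esub> x i) \<in> carrier (direct_sum I M)"
      using x by (auto simp: mem abelian_group.a_inv_closed[OF group])
    moreover have "(\<lambda>i\<in>I. \<ominus>\<^bsub>M i\<^esub> x i) \<oplus>\<^bsub>direct_sum I M\<^esub> x = \<zero>\<^bsub>direct_sum I M\<^esub>"
      using x by (auto simp: mem abelian_group.l_neg[OF group] intro!: restrict_ext)
    ultimately show "\<exists>y\<in>carrier (direct_sum I M). y \<oplus>\<^bsub>direct_sum I M\<^esub> x = \<zero>\<^bsub>direct_sum I M\<^esub>"
      by blast
  next
    fix x assume x: "x \<in> carrier (direct_sum I M)"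
    then have "x \<in> (\<Pi>\<^sub>E i\<in>I. carrier (M i))" by simp
    note ext = PiE_ext[OF _ this]
    show "\<zero>\<^bsub>direct_sum I M\<^esub> \<oplus>\<^bsub>direct_sum I M\<^esub> x = x"
      using x by (intro ext) (auto simp: mem abelian_monoid.l_zero[OF monoid])
    show "\<one>\<^bsub>R\<^esub> \<odot>\<^bsub>direct_sum I M\<^esub> x = x"
      using x by (intro ext) (auto simp: mem module.smult_one[OF M])
  next
    fix x y z
    assume "x \<in> carrier (direct_sum I M)" "y \<in> carrier (direct_sum I M)" "z \<in> carrier (direct_sum I M)"
    then show "x \<oplus>\<^bsub>direct_sum I M\<^esub> y \<oplus>\<^bsub>direct_sum I M\<^esub> z = x \<oplus>\<^bsub>direct_sum I M\<^esub> (y \<oplus>\<^bsub>direct_sum I M\<^esub> z)"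
      by (auto simp: mem abelian_monoid.a_assoc[OF monoid] intro!: restrict_ext)
  next
    fix x y
    assume "x \<in> carrier (direct_sum I M)" "y \<in> carrier (direct_sum I M)"
    then show "x \<oplus>\<^bsub>direct_sum I M\<^esub> y = y \<oplus>\<^bsub>direct_sum I M\<^esub> x"
      by (auto simp: mem intro!: restrict_ext abelian_monoid.a_comm[OF monoid])
  qed (auto simp: mem abelian_monoid.a_closed[OF monoid] abelian_monoid.zero_closed[OF monoid]
      module.smult_closed[OF M] module.smult_l_distr[OF M] module.smult_r_distr[OF M]
      module.smult_assoc1[OF M] intro!: restrict_ext)
qed

section \<open>Free modules of finite rank: universal property and projectivity\<close>

definition free_module :: "('r, 'x) ring_scheme \<Rightarrow> 'i set \<Rightarrow> ('r, 'i \<Rightarrow> 'r) module" where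
  "free_module R I = direct_sum I (\<lambda>_. regular_module R)"

definition unit_vec :: "('r, 'x) ring_scheme \<Rightarrow> 'i set \<Rightarrow> 'i \<Rightarrow> 'i \<Rightarrow> 'r" where
  "unit_vec R I i = (\<lambda>j\<in>I. if j = i then \<one>\<^bsub>R\<^esub> else \<zero>\<^bsub>R\<^esub>)"

lemma free_module_simps [simp]:
  "carrier (free_module R I) = (I \<rightarrow>\<^sub>E carrier R)"
  "\<zero>\<^bsub>free_module R I\<^esub> = (\<lambda>i\<in>I. \<zero>\<^bsub>R\<^esub>)"
  "f \<oplus>\<^bsub>free_module R I\<^esub> g = (\<lambda>i\<in>I. f i \<oplus>\<^bsub>R\<^esub> g i)"
  "r \<odot>\<^bsub>free_module R I\<^esub> f = (\<lambda>i\<in>I. r \<otimes>\<^bsub>R\<^esub> f i)"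
  by (simp_all add: free_module_def)

lemma module_free_module: "cring R \<Longrightarrow> module R (free_module R I)"
  unfolding free_module_def by (intro module_direct_sum module_regular_module)

lemma (in cring) unit_vec_closed [simp]: "unit_vec R I i \<in> I \<rightarrow>\<^sub>E carrier R"
  by (auto simp: unit_vec_def)

lemma (in cring) free_module_span:
  assumes I: "finite I" and H: "submodule H R (free_module R I)"
    and unit: "\<And>i. i \<in> I \<Longrightarrow> unit_vec R I i \<in> H"
  shows "H = carrier (free_module R I)"
proof
  interpret F: module R "free_module R I" by (rule module_free_module[OF cring_axioms])
  note HE = F.submoduleE[OF H] F.submodule_zero[OF H]
  show "H \<subseteq> carrier (free_module R I)" by (rule HE(1))
  show "carrier (free_module R I) \<subseteq> H"
  proof
    fix x assume x: "x \<in> carrier (free_module R I)"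
    have mem: "x i \<in> carrier R" if "i \<in> I" for i
      using x that by auto
    \<comment> \<open>Induction on the set of coordinates kept: each new coordinate adds one
      multiple of a unit vector, and \<open>J = I\<close> gives \<open>x\<close> itself.\<close>
    have "(\<lambda>i\<in>I. if i \<in> J then x i else \<zero>) \<in> H" if "J \<subseteq> I" for J
      using finite_subset[OF that I] that
    proof (induction J rule: finite_induct)
      case empty
      then show ?case using HE(7) by (simp only: free_module_simps empty_iff if_False)
    next
      case (insert j J)
      then have xj: "x j \<in> carrier R" by (simp add: mem)
      have "(\<lambda>i\<in>I. if i \<in> insert j J then x i else \<zero>) =
          (\<lambda>i\<in>I. if i \<in> J then x i else \<zero>) \<oplus>\<^bsub>free_module R I\<^esub> x j \<odot>\<^bsub>free_module R I\<^esub> unit_vec R I j"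
        using insert x by (auto simp: unit_vec_def mem intro!: restrict_ext)
      also have "\<dots> \<in> H"
        using insert.IH insert.prems xj by (intro HE(4,5) unit) blast+
      finally show ?case .
    qed
    from this[of I] x show "x \<in> H" by (simp add: PiE_def extensional_restrict cong: restrict_cong)
  qed
qed

lemma (in cring) fin_gen_free_module:
  assumes "finite I"
  shows "fin_gen R (free_module R I)"
  unfolding fin_gen_def
proof (intro exI[of _ "unit_vec R I ` I"] conjI allI impI)
  fix H assume "submodule H R (free_module R I) \<and> unit_vec R I ` I \<subseteq> H"
  then show "H = carrier (free_module R I)"
    by (intro free_module_span[OF assms]) auto
qed (use assms in \<open>simp_all add: image_subset_iff\<close>)

lemma (in cring) free_module_hom_eqI:
  assumes "finite I" "module R M" "f \<in> mod_hom R (free_module R I) M" "g \<in> mod_hom R (free_module R I) M"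
    and "\<And>i. i \<in> I \<Longrightarrow> f (unit_vec R I i) = g (unit_vec R I i)"
  shows "f = g"
proof -
  let ?F = "free_module R I"
  have "{x \<in> carrier ?F. f x = g x} = carrier ?F"
    using assms
    by (intro free_module_span submodule_equalizer module_free_module[OF cring_axioms]) auto
  then show ?thesis
    using mod_hom_extensional[OF assms(3)] mod_hom_extensional[OF assms(4)]
    by (intro extensionalityI[of f "carrier ?F"]) auto
qed

text \<open>The map takes \<open>x\<close> to the linear combination of the \<open>y i\<close> with
  coefficients \<open>x i\<close>. With \<open>free_module_hom_eqI\<close> this is the universal
  property of the free module.\<close>

lemma free_module_hom_exists:
  assumes "finite I" "module R M" and y: "\<And>i. i \<in> I \<Longrightarrow> y i \<in> carrier M"
  shows "\<exists>h\<in>mod_hom R (free_module R I) M. \<forall>i\<in>I. h (unit_vec R I i) = y i"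
proof (rule bexI)
  interpret M: module R M by fact
  let ?F = "free_module R I"
  let ?h = "\<lambda>x\<in>carrier ?F. \<Oplus>\<^bsub>M\<^esub>i\<in>I. x i \<odot>\<^bsub>M\<^esub> y i"
  interpret F: module R ?F by (rule module_free_module[OF M.R.cring_axioms])
  have mem: "x i \<in> carrier R" if "x \<in> I \<rightarrow>\<^sub>E carrier R" "i \<in> I" for x i
    using that by (rule PiE_mem)
  have closed: "(\<lambda>i. x i \<odot>\<^bsub>M\<^esub> y i) \<in> I \<rightarrow> carrier M" if "x \<in> carrier ?F" for x
    using that y by auto
  show "?h \<in> mod_hom R ?F M"
  proof (rule mod_homI)
    fix x assume "x \<in> carrier ?F"
    then show "?h x \<in> carrier M" using closed by (simp add: M.M.finsum_closed)
  next
    fix x x' assume x: "x \<in> carrier ?F" "x' \<in> carrier ?F"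
    have "(\<Oplus>\<^bsub>M\<^esub>i\<in>I. (x \<oplus>\<^bsub>?F\<^esub> x') i \<odot>\<^bsub>M\<^esub> y i) = (\<Oplus>\<^bsub>M\<^esub>i\<in>I. x i \<odot>\<^bsub>M\<^esub> y i \<oplus>\<^bsub>M\<^esub> x' i \<odot>\<^bsub>M\<^esub> y i)"
      using x y by (intro M.M.finsum_cong') (auto simp: mem M.smult_l_distr)
    also have "\<dots> = (\<Oplus>\<^bsub>M\<^esub>i\<in>I. x i \<odot>\<^bsub>M\<^esub> y i) \<oplus>\<^bsub>M\<^esub> (\<Oplus>\<^bsub>M\<^esub>i\<in>I. x' i \<odot>\<^bsub>M\<^esub> y i)"
      using x closed by (intro M.M.finsum_addf) auto
    finally show "?h (x \<oplus>\<^bsub>?F\<^esub> x') = ?h x \<oplus>\<^bsub>M\<^esub> ?h x'"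
      using x F.M.a_closed[OF x] by simp
  next
    fix r x assume x: "r \<in> carrier R" "x \<in> carrier ?F"
    have "(\<Oplus>\<^bsub>M\<^esub>i\<in>I. (r \<odot>\<^bsub>?F\<^esub> x) i \<odot>\<^bsub>M\<^esub> y i) = (\<Oplus>\<^bsub>M\<^esub>i\<in>I. r \<odot>\<^bsub>M\<^esub> (x i \<odot>\<^bsub>M\<^esub> y i))"
      using x y by (intro M.M.finsum_cong') (auto simp: mem M.smult_assoc1)
    also have "\<dots> = r \<odot>\<^bsub>M\<^esub> (\<Oplus>\<^bsub>M\<^esub>i\<in>I. x i \<odot>\<^bsub>M\<^esub> y i)"
      using x closed assms(1) by (intro M.finsum_smult_ldistr[symmetric]) auto
    finally show "?h (r \<odot>\<^bsub>?F\<^esub> x) = r \<odot>\<^bsub>M\<^esub> ?h x"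
      using x F.smult_closed[OF x] by simp
  qed simp
  show "\<forall>i\<in>I. ?h (unit_vec R I i) = y i"
  proof
    fix i assume i: "i \<in> I"
    have "(\<Oplus>\<^bsub>M\<^esub>j\<in>I. unit_vec R I i j \<odot>\<^bsub>M\<^esub> y j) = (\<Oplus>\<^bsub>M\<^esub>j\<in>I. if i = j then y j else \<zero>\<^bsub>M\<^esub>)"
      using y by (intro M.M.finsum_cong') (auto simp: unit_vec_def)
    also have "\<dots> = y i" using i y assms(1) by (subst M.M.finsum_singleton) auto
    finally show "?h (unit_vec R I i) = y i" using M.R.unit_vec_closed by simp
  qed
qed

text \<open>To lift \<open>f\<close> along a surjection \<open>g\<close>, choose preimages of the
  images of the unit vectors and extend linearly; \<open>compose g h\<close> and \<open>f\<close>
  agree on unit vectors.\<close>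

lemma (in cring) free_module_fg_projective:
  assumes "finite I"
  shows "free_module R I \<in> fg_projective R"
proof -
  let ?F = "free_module R I"
  have F: "module R ?F" by (rule module_free_module[OF cring_axioms])
  have "\<exists>h\<in>mod_hom R ?F X. compose (carrier ?F) g h = f"
    if X: "X \<in> fg_modules R" and Y: "Y \<in> fg_modules R" and g: "g \<in> mod_hom R X Y"
      and f: "f \<in> mod_hom R ?F Y" and surj: "g ` carrier X = carrier Y"
    for X Y :: "'a cmodule" and g f
  proof -
    have XY: "module R X" "module R Y" using X Y by (auto simp: fg_modules_def)
    \<comment> \<open>For \<open>i\<close> outside \<open>I\<close> the unit vector is the zero
      vector, still in the carrier, so the choice can be made for all \<open>i\<close> at
      once.\<close>
    have "\<exists>x\<in>carrier X. g x = f (unit_vec R I i)" for i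
    proof -
      have "f (unit_vec R I i) \<in> carrier Y"
        using unit_vec_closed by (intro mod_hom_closed[OF f]) simp
      then show ?thesis using surj by (metis imageE)
    qed
    then obtain y where y: "\<And>i. y i \<in> carrier X" "\<And>i. g (y i) = f (unit_vec R I i)" by metis
    obtain h where h: "h \<in> mod_hom R ?F X" "\<And>i. i \<in> I \<Longrightarrow> h (unit_vec R I i) = y i"
      using free_module_hom_exists[OF assms XY(1), of y] y(1) by blast
    have "compose (carrier ?F) g h = f"
      using assms XY h y f g unit_vec_closed
      by (intro free_module_hom_eqI[of I Y] mod_hom_compose[OF F]) (auto simp: compose_eq)
    then show ?thesis using h by blast
  qed
  then show ?thesis
    unfolding fg_projective_def using F fin_gen_free_module[OF assms]
    by (auto simp: fg_modules_def)
qed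

text \<open>The last hypothesis says that any two nonzero cyclic submodules meet nontrivially. In a
  direct sum of two nonzero modules, elements taken from different summands violate this.\<close>

lemma uniform_imp_indecomposable_in:
  assumes C: "C \<subseteq> fg_modules R" "M \<in> C" and "\<not> zero_module M"
    and uniform: "\<And>x y. x \<in> carrier M - {\<zero>\<^bsub>M\<^esub>} \<Longrightarrow> y \<in> carrier M - {\<zero>\<^bsub>M\<^esub>} \<Longrightarrow>
      \<exists>r\<in>carrier R. \<exists>s\<in>carrier R. r \<odot>\<^bsub>M\<^esub> x = s \<odot>\<^bsub>M\<^esub> y \<and> r \<odot>\<^bsub>M\<^esub> x \<noteq> \<zero>\<^bsub>M\<^esub>"
  shows "indecomposable_in R C M"
  unfolding indecomposable_in_def
proof (intro conjI allI impI assms)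
  fix X :: "nat \<Rightarrow> 'a cmodule"
  assume X: "X 0 \<in> C \<and> X 1 \<in> C \<and> mod_iso R M (direct_sum {0, 1} X)"
  let ?S = "direct_sum {0, 1} X"
  have modX: "module R (X 0)" "module R (X 1)" and M: "module R M"
    using X C by (auto simp: fg_modules_def)
  interpret M: module R M by fact
  interpret X0: module R "X 0" by fact
  interpret X1: module R "X 1" by fact
  interpret S: module R ?S using modX by (intro module_direct_sum M.R.cring_axioms) auto
  obtain f where f: "f \<in> mod_hom R M ?S" "bij_betw f (carrier M) (carrier ?S)"
    using X unfolding mod_iso_def by blast
  have f0: "f \<zero>\<^bsub>M\<^esub> = \<zero>\<^bsub>?S\<^esub>" using M S.module_axioms f(1) by (rule mod_hom_zero)
  show "zero_module (X 0) \<or> zero_module (X 1)"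
  proof (rule ccontr)
    assume "\<not> ?thesis"
    then obtain u v where u: "u \<in> carrier (X 0)" "u \<noteq> \<zero>\<^bsub>X 0\<^esub>" and v: "v \<in> carrier (X 1)" "v \<noteq> \<zero>\<^bsub>X 1\<^esub>"
      unfolding zero_module_def by blast
    \<comment> \<open>\<open>a\<close> and \<open>b\<close> are nonzero and live in one summand
      each; \<open>x\<close> and \<open>y\<close> below are the elements of \<open>M\<close> that
      correspond to them.\<close>
    define a where "a = (\<lambda>i\<in>{0, 1 :: nat}. if i = 0 then u else \<zero>\<^bsub>X 1\<^esub>)"
    define b where "b = (\<lambda>i\<in>{0, 1 :: nat}. if i = 0 then \<zero>\<^bsub>X 0\<^esub> else v)"
    have "a \<in> carrier ?S" "b \<in> carrier ?S" using u v X1.M.zero_closed by (auto simp: a_def b_def)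
    then obtain x y where xy: "x \<in> carrier M" "f x = a" "y \<in> carrier M" "f y = b"
      using f(2) unfolding bij_betw_def by (metis imageE)
    have "a 0 \<noteq> \<zero>\<^bsub>?S\<^esub> 0" "b 1 \<noteq> \<zero>\<^bsub>?S\<^esub> 1" using u v by (simp_all add: a_def b_def)
    then have "x \<noteq> \<zero>\<^bsub>M\<^esub>" "y \<noteq> \<zero>\<^bsub>M\<^esub>" using xy f0 by metis+
    then obtain r s where rs: "r \<in> carrier R" "s \<in> carrier R" "r \<odot>\<^bsub>M\<^esub> x = s \<odot>\<^bsub>M\<^esub> y" "r \<odot>\<^bsub>M\<^esub> x \<noteq> \<zero>\<^bsub>M\<^esub>"
      using uniform[of x y] xy by blast
    have fr: "f (r \<odot>\<^bsub>M\<^esub> x) = r \<odot>\<^bsub>?S\<^esub> a"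
      using mod_hom_smult[OF f(1)] rs(1) xy by metis
    moreover have "f (s \<odot>\<^bsub>M\<^esub> y) = s \<odot>\<^bsub>?S\<^esub> b"
      using mod_hom_smult[OF f(1)] rs(2) xy by metis
    ultimately have eq: "r \<odot>\<^bsub>?S\<^esub> a = s \<odot>\<^bsub>?S\<^esub> b" using rs(3) by simp
    \<comment> \<open>At coordinate 0 the vector \<open>b\<close> vanishes, so the common multiple
      vanishes there; at coordinate 1 it vanishes because \<open>a\<close> does.\<close>
    have "r \<odot>\<^bsub>X 0\<^esub> u = \<zero>\<^bsub>X 0\<^esub>"
      using fun_cong[OF eq, of 0] rs by (simp add: a_def b_def)
    moreover have "r \<odot>\<^bsub>X 1\<^esub> \<zero>\<^bsub>X 1\<^esub> = \<zero>\<^bsub>X 1\<^esub>" by (rule X1.smult_r_null[OF rs(1)])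
    ultimately have "f (r \<odot>\<^bsub>M\<^esub> x) = f \<zero>\<^bsub>M\<^esub>"
      unfolding fr f0 by (auto simp: a_def intro!: restrict_ext)
    then have "r \<odot>\<^bsub>M\<^esub> x = \<zero>\<^bsub>M\<^esub>"
      using f(2) rs xy by (auto simp: bij_betw_def dest: inj_onD)
    then show False using rs by blast
  qed
qed

section \<open>The periodic complex\<close>

abbreviation dual_free :: "nat \<Rightarrow> (nat \<Rightarrow> int) set cmodule" where
  "dual_free k \<equiv> free_module int_dual_numbers {..<2 * k}"

text \<open>Coordinates \<open>2 j\<close> and \<open>2 j + 1\<close> form the \<open>j\<close>-th block, on which \<open>dmap\<close> acts by
  \<open>[[\<epsilon>, -n j], [0, \<epsilon>]]\<close>.\<close>

definition dmap :: "nat \<Rightarrow> (nat \<Rightarrow> int) \<Rightarrow> (nat \<Rightarrow> (nat \<Rightarrow> int) set) \<Rightarrow> (nat \<Rightarrow> (nat \<Rightarrow> int) set)" where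
  "dmap k n = (\<lambda>x\<in>carrier (dual_free k). \<lambda>i\<in>{..<2 * k}.
     if even i
     then dual_num 0 1 \<otimes>\<^bsub>int_dual_numbers\<^esub> x i \<oplus>\<^bsub>int_dual_numbers\<^esub>
       dual_num (- n (i div 2)) 0 \<otimes>\<^bsub>int_dual_numbers\<^esub> x (Suc i)
     else dual_num 0 1 \<otimes>\<^bsub>int_dual_numbers\<^esub> x i)"

lemma Suc_even_less_double: "even i \<Longrightarrow> i < 2 * k \<Longrightarrow> Suc i < 2 * (k :: nat)"
  by presburger

lemma all_less_double: "(\<forall>i<2 * k. P i) \<longleftrightarrow> (\<forall>j<k. P (2 * j) \<and> P (Suc (2 * j)))" for k :: nat
proof (intro iffI allI impI)
  fix i assume "\<forall>j<k. P (2 * j) \<and> P (Suc (2 * j))" "i < 2 * k"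
  then show "P i"
    by (cases "even i") (auto elim!: evenE oddE)
qed auto

lemma module_dual_free: "module int_dual_numbers (dual_free k)"
  by (rule module_free_module[OF int_dual_numbers_cring])

lemma dual_free_mem:
  "x \<in> {..<2 * k} \<rightarrow>\<^sub>E carrier int_dual_numbers \<Longrightarrow> i < 2 * k \<Longrightarrow> x i \<in> carrier int_dual_numbers"
  by (rule PiE_mem) auto

text \<open>Identities between vectors become integer equations here, which arithmetic
  simplification settles.\<close>

lemma dual_free_eq_iff:
  assumes "x \<in> carrier (dual_free k)" "y \<in> carrier (dual_free k)"
  shows "x = y \<longleftrightarrow> (\<forall>i<2 * k. re (x i) = re (y i) \<and> im (x i) = im (y i))"
proof -
  have "x = y \<longleftrightarrow> (\<forall>i<2 * k. x i = y i)"
    using PiE_ext[OF assms[unfolded free_module_simps]] by auto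
  also have "\<dots> \<longleftrightarrow> (\<forall>i<2 * k. re (x i) = re (y i) \<and> im (x i) = im (y i))"
    using dual_free_mem[OF assms(1)[unfolded free_module_simps]]
      dual_free_mem[OF assms(2)[unfolded free_module_simps]]
    by (intro all_cong dual_eq_iff) blast+
  finally show ?thesis .
qed

lemma dmap_closed: "x \<in> carrier (dual_free k) \<Longrightarrow> dmap k n x \<in> carrier (dual_free k)"
  by (auto simp: dmap_def dual_free_mem Suc_even_less_double)

lemma re_im_dmap:
  assumes "x \<in> carrier (dual_free k)" "i < 2 * k"
  shows "re (dmap k n x i) = (if even i then - n (i div 2) * re (x (Suc i)) else 0)"
    and "im (dmap k n x i) = (if even i then re (x i) - n (i div 2) * im (x (Suc i)) else re (x i))"
  using assms by (auto simp: dmap_def dual_free_mem Suc_even_less_double)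

lemma dmap_hom: "dmap k n \<in> mod_hom int_dual_numbers (dual_free k) (dual_free k)"
proof (rule mod_homI)
  interpret F: module int_dual_numbers "dual_free k" by (rule module_dual_free)
  have mem: "x i \<in> carrier int_dual_numbers" if "x \<in> carrier (dual_free k)" "i < 2 * k" for x i
    using that by (simp add: dual_free_mem)
  fix x y assume x: "x \<in> carrier (dual_free k)" and y: "y \<in> carrier (dual_free k)"
  note xy = F.M.a_closed[OF x y] and Dx = dmap_closed[OF x, of n] and Dy = dmap_closed[OF y, of n]
  have "re (dmap k n (x \<oplus>\<^bsub>dual_free k\<^esub> y) i) = re ((dmap k n x \<oplus>\<^bsub>dual_free k\<^esub> dmap k n y) i)"
    "im (dmap k n (x \<oplus>\<^bsub>dual_free k\<^esub> y) i) = im ((dmap k n x \<oplus>\<^bsub>dual_free k\<^esub> dmap k n y) i)"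
    if "i < 2 * k" for i
    using that unfolding re_im_dmap[OF xy that]
    by ((simp add: mem[OF x] mem[OF y] mem[OF Dx] mem[OF Dy] re_im_dmap[OF x] re_im_dmap[OF y]
        Suc_even_less_double; simp add: algebra_simps)+)
  then show "dmap k n (x \<oplus>\<^bsub>dual_free k\<^esub> y) = dmap k n x \<oplus>\<^bsub>dual_free k\<^esub> dmap k n y"
    using dual_free_eq_iff[OF dmap_closed[OF xy] F.M.a_closed[OF Dx Dy]] by blast
next
  interpret F: module int_dual_numbers "dual_free k" by (rule module_dual_free)
  have mem: "x i \<in> carrier int_dual_numbers" if "x \<in> carrier (dual_free k)" "i < 2 * k" for x i
    using that by (simp add: dual_free_mem)
  fix r x assume r: "r \<in> carrier int_dual_numbers" and x: "x \<in> carrier (dual_free k)"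
  note rx = F.smult_closed[OF r x] and Dx = dmap_closed[OF x, of n]
  have "re (dmap k n (r \<odot>\<^bsub>dual_free k\<^esub> x) i) = re ((r \<odot>\<^bsub>dual_free k\<^esub> dmap k n x) i)"
    "im (dmap k n (r \<odot>\<^bsub>dual_free k\<^esub> x) i) = im ((r \<odot>\<^bsub>dual_free k\<^esub> dmap k n x) i)"
    if "i < 2 * k" for i
    using that unfolding re_im_dmap[OF rx that]
    by ((simp add: r mem[OF x] mem[OF Dx] re_im_dmap[OF x] Suc_even_less_double;
        simp add: algebra_simps)+)
  then show "dmap k n (r \<odot>\<^bsub>dual_free k\<^esub> x) = r \<odot>\<^bsub>dual_free k\<^esub> dmap k n x"
    using dual_free_eq_iff[OF dmap_closed[OF rx] F.smult_closed[OF r Dx]] by blast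
next
  show "dmap k n \<in> extensional (carrier (dual_free k))" by (simp add: dmap_def)
qed (rule dmap_closed)

text \<open>The odd rows kill the real parts of the odd coordinates, and the even rows then tie the
  real part of each even coordinate to the next imaginary part. The free parameters of block j are
  the imaginary parts a and b of its two coordinates, and \<epsilon> sends (a, b) to (n j * b, 0):
  the block is \<open>L\<^sub>n\<close> with n = n j.\<close>

lemma kernel_dmap:
  "a_kernel (dual_free k) (dual_free k) (dmap k n) = {x \<in> carrier (dual_free k).
     \<forall>j<k. re (x (Suc (2 * j))) = 0 \<and> re (x (2 * j)) = n j * im (x (Suc (2 * j)))}"
proof -
  interpret F: module int_dual_numbers "dual_free k" by (rule module_dual_free)
  have "dmap k n x = \<zero>\<^bsub>dual_free k\<^esub> \<longleftrightarrow>
      (\<forall>j<k. re (x (Suc (2 * j))) = 0 \<and> re (x (2 * j)) = n j * im (x (Suc (2 * j))))"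
    if x: "x \<in> carrier (dual_free k)" for x
  proof -
    have "dmap k n x = \<zero>\<^bsub>dual_free k\<^esub> \<longleftrightarrow> (\<forall>i<2 * k. re (dmap k n x i) = 0 \<and> im (dmap k n x i) = 0)"
      by (subst dual_free_eq_iff[OF dmap_closed[OF x] F.M.zero_closed]) simp
    also have "\<dots> \<longleftrightarrow> (\<forall>j<k. re (x (Suc (2 * j))) = 0 \<and> re (x (2 * j)) = n j * im (x (Suc (2 * j))))"
      unfolding all_less_double by (intro all_cong) (auto simp: re_im_dmap[OF x])
    finally show ?thesis .
  qed
  then show ?thesis unfolding a_kernel_def' by blast
qed

text \<open>The two matrices with opposite signs multiply to \<epsilon>^2 = 0, which gives one
  inclusion; the other needs an explicit preimage.\<close>

lemma image_dmap:
  "dmap k (\<lambda>j. - n j) ` carrier (dual_free k) = a_kernel (dual_free k) (dual_free k) (dmap k n)"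
proof
  show "dmap k (\<lambda>j. - n j) ` carrier (dual_free k) \<subseteq> a_kernel (dual_free k) (dual_free k) (dmap k n)"
  proof
    fix y assume "y \<in> dmap k (\<lambda>j. - n j) ` carrier (dual_free k)"
    then obtain x where x: "x \<in> carrier (dual_free k)" "y = dmap k (\<lambda>j. - n j) x" by blast
    then show "y \<in> a_kernel (dual_free k) (dual_free k) (dmap k n)"
      unfolding kernel_dmap using dmap_closed[OF x(1), of "\<lambda>j. - n j"]
      by (simp add: re_im_dmap[OF x(1)])
  qed
  show "a_kernel (dual_free k) (dual_free k) (dmap k n) \<subseteq> dmap k (\<lambda>j. - n j) ` carrier (dual_free k)"
  proof
    fix x assume "x \<in> a_kernel (dual_free k) (dual_free k) (dmap k n)"
    then have x: "x \<in> carrier (dual_free k)"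
      and ker: "\<And>j. j < k \<Longrightarrow> re (x (Suc (2 * j))) = 0 \<and> re (x (2 * j)) = n j * im (x (Suc (2 * j)))"
      unfolding kernel_dmap by blast+
    \<comment> \<open>In a kernel element the imaginary parts determine everything. Placed as real
      parts in \<open>y\<close>, they are moved back by the \<epsilon> on the diagonal, while the
      off-diagonal entry \<open>n j\<close> restores the real part of the even coordinate.\<close>
    define y where "y = (\<lambda>i\<in>{..<2 * k}. dual_num (im (x i)) 0)"
    have y: "y \<in> carrier (dual_free k)" by (simp add: y_def)
    have "\<forall>i<2 * k. re (x i) = re (dmap k (\<lambda>j. - n j) y i) \<and> im (x i) = im (dmap k (\<lambda>j. - n j) y i)"
      unfolding all_less_double by (auto simp: re_im_dmap[OF y] ker) (auto simp: y_def)
    then have "x = dmap k (\<lambda>j. - n j) y"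
      using dual_free_eq_iff[OF x dmap_closed[OF y]] by blast
    then show "x \<in> dmap k (\<lambda>j. - n j) ` carrier (dual_free k)" using y by blast
  qed
qed

section \<open>The columns of \<open>dmap\<close> and exactness of the dual\<close>

lemma dmap_unit_vec:
  assumes "j < k"
  shows "dmap k n (unit_vec int_dual_numbers {..<2 * k} (2 * j)) =
      dual_num 0 1 \<odot>\<^bsub>dual_free k\<^esub> unit_vec int_dual_numbers {..<2 * k} (2 * j)" (is ?even)
    and "dmap k n (unit_vec int_dual_numbers {..<2 * k} (Suc (2 * j))) =
      dual_num 0 1 \<odot>\<^bsub>dual_free k\<^esub> unit_vec int_dual_numbers {..<2 * k} (Suc (2 * j)) \<oplus>\<^bsub>dual_free k\<^esub>
      dual_num (- n j) 0 \<odot>\<^bsub>dual_free k\<^esub> unit_vec int_dual_numbers {..<2 * k} (2 * j)" (is ?odd)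
proof -
  interpret F: module int_dual_numbers "dual_free k" by (rule module_dual_free)
  have u: "unit_vec int_dual_numbers {..<2 * k} i \<in> carrier (dual_free k)" for i by simp
  show ?even
    by (subst dual_free_eq_iff[OF dmap_closed[OF u] F.smult_closed[OF dual_num_closed u]],
        unfold all_less_double)
      (use assms in \<open>simp add: re_im_dmap[OF u]; auto simp: unit_vec_def Suc_double_not_eq_double\<close>)
  show ?odd
    by (subst dual_free_eq_iff[OF dmap_closed[OF u]
          F.M.a_closed[OF F.smult_closed[OF dual_num_closed u] F.smult_closed[OF dual_num_closed u]]],
        unfold all_less_double)
      (use assms in \<open>simp add: re_im_dmap[OF u]; auto simp: unit_vec_def Suc_double_not_eq_double\<close>)
qed

text \<open>A functional is the row of its values on unit vectors, and precomposition with
  \<open>dmap\<close> acts on it by the transpose. Transposing a block only exchanges the roles of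
  its two coordinates, so the argument of \<open>image_dmap\<close> works again.\<close>

lemma dual_dmap_exact:
  defines "R \<equiv> int_dual_numbers"
  assumes g: "g \<in> mod_hom R (dual_free k) (regular_module R)"
    and zero: "\<And>x. x \<in> carrier (dual_free k) \<Longrightarrow> g (dmap k n x) = \<zero>\<^bsub>R\<^esub>"
  shows "\<exists>h\<in>mod_hom R (dual_free k) (regular_module R).
    compose (carrier (dual_free k)) h (dmap k (\<lambda>j. - n j)) = g"
proof -
  interpret F: module int_dual_numbers "dual_free k" by (rule module_dual_free)
  let ?e = "unit_vec int_dual_numbers {..<2 * k}"
  have reg: "module R (regular_module R)"
    unfolding R_def by (rule module_regular_module[OF int_dual_numbers_cring])
  have e: "?e i \<in> carrier (dual_free k)" for i by simp
  have hom_dmap: "f (dmap k m (?e (2 * j))) = dual_num 0 1 \<otimes>\<^bsub>R\<^esub> f (?e (2 * j))"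
    "f (dmap k m (?e (Suc (2 * j)))) = dual_num 0 1 \<otimes>\<^bsub>R\<^esub> f (?e (Suc (2 * j))) \<oplus>\<^bsub>R\<^esub>
      dual_num (- m j) 0 \<otimes>\<^bsub>R\<^esub> f (?e (2 * j))"
    if f: "f \<in> mod_hom R (dual_free k) (regular_module R)" and j: "j < k" for f m j
    unfolding dmap_unit_vec[OF j] R_def using f e[of "2 * j"] e[of "Suc (2 * j)"]
    by (simp_all add: R_def mod_hom_add[OF f[unfolded R_def]] mod_hom_smult[OF f[unfolded R_def]] F.smult_closed
        del: free_module_simps)
  have closed: "f (?e i) \<in> carrier int_dual_numbers"
    if f: "f \<in> mod_hom R (dual_free k) (regular_module R)" for f i
    using mod_hom_closed[OF f e] by (simp add: R_def)
  \<comment> \<open>The equations are the imaginary parts of \<open>g\<close> applied to the even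
    and odd columns; compare \<open>kernel_dmap\<close> with even and odd exchanged.\<close>
  have g_even: "re (g (?e (2 * j))) = 0" and g_odd: "re (g (?e (Suc (2 * j)))) = n j * im (g (?e (2 * j)))"
    if j: "j < k" for j
  proof -
    show *: "re (g (?e (2 * j))) = 0"
      using zero[OF e, of "2 * j"] closed[OF g, of "2 * j"]
      by (auto simp: hom_dmap[OF g j] R_def dual_eq_iff)
    show "re (g (?e (Suc (2 * j)))) = n j * im (g (?e (2 * j)))"
      using zero[OF e, of "Suc (2 * j)"] closed[OF g, of "2 * j"] closed[OF g, of "Suc (2 * j)"] *
      by (auto simp: hom_dmap[OF g j] R_def dual_eq_iff)
  qed
  \<comment> \<open>As for \<open>y\<close> in \<open>image_dmap\<close>, the imaginary parts of the
    values of \<open>g\<close> become the real parts of the values of \<open>h\<close>.\<close>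
  obtain h where h: "h \<in> mod_hom R (dual_free k) (regular_module R)"
    and he: "\<And>i. i < 2 * k \<Longrightarrow> h (?e i) = dual_num (im (g (?e i))) 0"
    using free_module_hom_exists[of "{..<2 * k}" R "regular_module R" "\<lambda>i. dual_num (im (g (?e i))) 0"] reg
    by (auto simp: R_def)
  let ?hd = "compose (carrier (dual_free k)) h (dmap k (\<lambda>j. - n j))"
  have hd: "?hd \<in> mod_hom R (dual_free k) (regular_module R)"
    using mod_hom_compose[OF module_dual_free dmap_hom] h by (simp add: R_def)
  have "\<forall>i<2 * k. ?hd (?e i) = g (?e i)"
    unfolding all_less_double
    by (auto simp: compose_eq hom_dmap[OF h] he R_def dual_eq_iff closed[OF g, unfolded R_def] g_even g_odd)
  then have "?hd = g"
    using reg hd g unfolding R_def by (intro dual.free_module_hom_eqI[of "{..<2 * k}"]) auto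
  then show ?thesis using h by blast
qed

section \<open>The kernels of \<open>dmap\<close> as Gorenstein-projective modules\<close>

definition dlattice :: "nat \<Rightarrow> (nat \<Rightarrow> int) \<Rightarrow> (nat \<Rightarrow> int) set cmodule" where
  "dlattice k n = (dual_free k)\<lparr>carrier := a_kernel (dual_free k) (dual_free k) (dmap k n)\<rparr>"

lemma carrier_dlattice: "carrier (dlattice k n) = {x \<in> {..<2 * k} \<rightarrow>\<^sub>E carrier int_dual_numbers.
     \<forall>j<k. re (x (Suc (2 * j))) = 0 \<and> re (x (2 * j)) = n j * im (x (Suc (2 * j)))}"
  by (simp add: dlattice_def kernel_dmap)

lemma dlattice_simps [simp]:
  "\<zero>\<^bsub>dlattice k n\<^esub> = (\<lambda>i\<in>{..<2 * k}. \<zero>\<^bsub>int_dual_numbers\<^esub>)"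
  "f \<oplus>\<^bsub>dlattice k n\<^esub> g = (\<lambda>i\<in>{..<2 * k}. f i \<oplus>\<^bsub>int_dual_numbers\<^esub> g i)"
  "r \<odot>\<^bsub>dlattice k n\<^esub> f = (\<lambda>i\<in>{..<2 * k}. r \<otimes>\<^bsub>int_dual_numbers\<^esub> f i)"
  by (simp_all add: dlattice_def)

lemma module_dlattice: "module int_dual_numbers (dlattice k n)"
  unfolding dlattice_def by (intro module_kernel module_dual_free dmap_hom)

lemma dlattice_in_fg_modules: "dlattice k n \<in> fg_modules int_dual_numbers"
proof -
  \<comment> \<open>The kernel is the image of a free module under the map with the opposite
    sign.\<close>
  have "fin_gen int_dual_numbers (dlattice k n)"
    unfolding dlattice_def image_dmap[symmetric]
    by (intro fin_gen_image module_dual_free dmap_hom dual.fin_gen_free_module) auto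
  then show ?thesis using module_dlattice by (simp add: fg_modules_def)
qed

lemma dual_differential_hom:
  assumes "\<And>i. module R (P i)" "exact_complex R P d"
  shows "dual_differential R P d i \<in> mod_hom R (dual_complex R P i) (dual_complex R P (i + 1))"
proof -
  interpret cring R using assms(1)[of 0] by (rule module.axioms)
  note P_closed = abelian_monoid.a_closed[OF abelian_group.axioms(1)[OF module.axioms(2)[OF assms(1)]]]
    module.smult_closed[OF assms(1)]
  \<comment> \<open>Exactness places the target of this map in degree -i - 1 + 1, which is
    -i.\<close>
  have d: "d (- i - 1) \<in> mod_hom R (P (- i - 1)) (P (- i))"
    using assms(2) unfolding exact_complex_def by (metis diff_add_cancel)
  have mem: "d (- i - 1) x \<in> carrier (P (- i))" if "x \<in> carrier (P (- i - 1))" for x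
    using mod_hom_closed[OF d that] .
  let ?H = "\<lambda>i. mod_hom R (P (- i)) (regular_module R)"
  have carr: "carrier (dual_complex R P i) = ?H i" for i
    by (simp add: dual_complex_def hom_module_def)
  have idx: "- (i + 1) = - i - 1" by simp
  have add_closed: "g \<oplus>\<^bsub>dual_complex R P i\<^esub> h \<in> ?H i" if "g \<in> ?H i" "h \<in> ?H i" for g h
    using mod_homD[OF that(1)] mod_homD[OF that(2)]
    by (intro mod_homI)
      (auto simp: dual_complex_def hom_module_def a_ac r_distr P_closed)
  have smult_closed: "r \<odot>\<^bsub>dual_complex R P i\<^esub> g \<in> ?H i" if "r \<in> carrier R" "g \<in> ?H i" for r g
    using mod_homD[OF that(2)] that(1)
    by (intro mod_homI)
      (auto simp: dual_complex_def hom_module_def r_distr m_ac P_closed)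
  have ext: "dual_differential R P d i \<in> extensional (carrier (dual_complex R P i))"
    by (simp add: dual_differential_def)
  have closed: "dual_differential R P d i g \<in> carrier (dual_complex R P (i + 1))"
    if "g \<in> carrier (dual_complex R P i)" for g
    using mod_hom_compose[OF assms(1) d] that by (simp add: dual_differential_def carr idx)
  have add: "dual_differential R P d i (g \<oplus>\<^bsub>dual_complex R P i\<^esub> h) =
      dual_differential R P d i g \<oplus>\<^bsub>dual_complex R P (i + 1)\<^esub> dual_differential R P d i h"
    if "g \<in> carrier (dual_complex R P i)" "h \<in> carrier (dual_complex R P i)" for g h
    using that add_closed[of g h] mem
    by (simp add: dual_differential_def carr)
      (auto simp: dual_complex_def hom_module_def compose_def idx intro!: restrict_ext)
  have smult: "dual_differential R P d i (r \<odot>\<^bsub>dual_complex R P i\<^esub> g) =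
      r \<odot>\<^bsub>dual_complex R P (i + 1)\<^esub> dual_differential R P d i g"
    if "r \<in> carrier R" "g \<in> carrier (dual_complex R P i)" for r g
    using that smult_closed[of r g] mem
    by (simp add: dual_differential_def carr)
      (auto simp: dual_complex_def hom_module_def compose_def idx intro!: restrict_ext)
  show ?thesis by (intro mod_homI ext closed add smult)
qed

lemma dlattice_in_G_proj: "dlattice k n \<in> G_proj int_dual_numbers"
proof -
  let ?R = "int_dual_numbers"
  \<comment> \<open>The differentials alternate between the two factors. Even degrees carry
    \<open>n\<close> itself, so that the kernel in degree 0 is \<open>dlattice k n\<close>.\<close>
  define m where "m i = (if even i then n else (\<lambda>j. - n j))" for i :: int
  define P where "P = (\<lambda>_ :: int. dual_free k)"
  define d where "d i = dmap k (m i)" for i :: int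
  have m: "m (i - 1) = (\<lambda>j. - m i j)" for i by (auto simp: m_def)
  have exact: "exact_complex ?R P d"
    unfolding exact_complex_def P_def d_def m using image_dmap dmap_hom by blast
  have "exact_complex ?R (dual_complex ?R P) (dual_differential ?R P d)"
    unfolding exact_complex_def
  proof (intro conjI allI)
    fix i
    show "dual_differential ?R P d i \<in> mod_hom ?R (dual_complex ?R P i) (dual_complex ?R P (i + 1))"
      using exact module_dual_free by (intro dual_differential_hom) (simp_all add: P_def)
    let ?H = "mod_hom ?R (dual_free k) (regular_module ?R)"
    have carr: "carrier (dual_complex ?R P i) = ?H" for i
      by (simp add: dual_complex_def hom_module_def P_def)
    have diff: "dual_differential ?R P d i g = compose (carrier (dual_free k)) g (d (- i - 1))"
      if "g \<in> ?H" for i g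
      using that by (simp add: dual_differential_def carr) (simp add: P_def)
    have zero: "\<zero>\<^bsub>dual_complex ?R P (i + 1)\<^esub> = (\<lambda>x\<in>carrier (dual_free k). \<zero>\<^bsub>?R\<^esub>)"
      by (simp add: dual_complex_def hom_module_def P_def)
    have reg: "module ?R (regular_module ?R)"
      by (rule module_regular_module[OF int_dual_numbers_cring])
    have "dual_differential ?R P d (i - 1) ` ?H = {g \<in> ?H. dual_differential ?R P d i g = \<zero>\<^bsub>dual_complex ?R P (i + 1)\<^esub>}"
    proof (intro equalityI subsetI)
      fix g assume "g \<in> dual_differential ?R P d (i - 1) ` ?H"
      then obtain h where h: "h \<in> ?H" and g: "g = compose (carrier (dual_free k)) h (d (- i))"
        by (auto simp: diff)
      have gH: "g \<in> ?H" unfolding g d_def by (intro mod_hom_compose[OF module_dual_free dmap_hom] h)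
      have "g (d (- i - 1) x) = \<zero>\<^bsub>?R\<^esub>" if x: "x \<in> carrier (dual_free k)" for x
      proof -
        \<comment> \<open>The composite of consecutive differentials is zero, so a functional that
          factors through \<open>d (- i)\<close> vanishes on the image of
          \<open>d (- i - 1)\<close>.\<close>
        have "d (- i - 1) x \<in> a_kernel (dual_free k) (dual_free k) (d (- i))"
          unfolding d_def m[of "- i"] using image_dmap[of k "m (- i)"] x by blast
        then show ?thesis
          using mod_hom_zero[OF module_dual_free reg h]
          by (simp add: g compose_eq a_kernel_def' del: free_module_simps)
      qed
      then have "dual_differential ?R P d i g = \<zero>\<^bsub>dual_complex ?R P (i + 1)\<^esub>"
        unfolding diff[OF gH] zero compose_def by (rule restrict_ext)
      then show "g \<in> {g \<in> ?H. dual_differential ?R P d i g = \<zero>\<^bsub>dual_complex ?R P (i + 1)\<^esub>}"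
        using gH by blast
    next
      fix g assume "g \<in> {g \<in> ?H. dual_differential ?R P d i g = \<zero>\<^bsub>dual_complex ?R P (i + 1)\<^esub>}"
      then have g: "g \<in> ?H" and "dual_differential ?R P d i g = \<zero>\<^bsub>dual_complex ?R P (i + 1)\<^esub>"
        by auto
      then have comp: "compose (carrier (dual_free k)) g (d (- i - 1)) = (\<lambda>x\<in>carrier (dual_free k). \<zero>\<^bsub>?R\<^esub>)"
        by (simp only: diff zero)
      have "g (dmap k (m (- i - 1)) x) = \<zero>\<^bsub>?R\<^esub>" if "x \<in> carrier (dual_free k)" for x
        using fun_cong[OF comp, of x] that by (simp add: compose_eq d_def del: free_module_simps)
      then obtain h where h: "h \<in> ?H"
        "compose (carrier (dual_free k)) h (dmap k (\<lambda>j. - m (- i - 1) j)) = g"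
        using dual_dmap_exact[OF g] by blast
      \<comment> \<open>The sign flip turns the factor of degree -i - 1 into that of degree -i, the
        map used by the dual differential in degree i - 1.\<close>
      moreover have "(\<lambda>j. - m (- i - 1) j) = m (- i)" by (simp add: m)
      ultimately have "dual_differential ?R P d (i - 1) h = g"
        by (simp add: diff d_def)
      then show "g \<in> dual_differential ?R P d (i - 1) ` ?H" using h by blast
    qed
    then show "dual_differential ?R P d (i - 1) ` carrier (dual_complex ?R P (i - 1)) =
        a_kernel (dual_complex ?R P i) (dual_complex ?R P (i + 1)) (dual_differential ?R P d i)"
      unfolding carr a_kernel_def' .
  qed
  moreover have "\<forall>i. P i \<in> fg_projective ?R"
    unfolding P_def by (intro allI dual.free_module_fg_projective) simp
  moreover have "mod_iso ?R (dlattice k n) ((P 0)\<lparr>carrier := a_kernel (P 0) (P 1) (d 0)\<rparr>)"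
    using mod_iso_refl[OF module_dlattice] by (simp add: P_def d_def m_def dlattice_def)
  ultimately have "gorenstein_projective ?R (dlattice k n)"
    unfolding gorenstein_projective_def using exact by blast
  then show ?thesis using dlattice_in_fg_modules by (simp add: G_proj_def)
qed

section \<open>Indecomposable lattices and the two decompositions\<close>

text \<open>The element (c, 0) of \<open>L\<^sub>n\<close>. The line b = 0 consists of the same
  vectors for every n, so n does not occur.\<close>

definition socle_elem :: "int \<Rightarrow> nat \<Rightarrow> (nat \<Rightarrow> int) set" where
  "socle_elem c = (\<lambda>i\<in>{..<2}. if i = 0 then dual_num 0 c else dual_num 0 0)"

lemma socle_elem_mem: "socle_elem c \<in> carrier (dlattice 1 n)"
  by (simp add: carrier_dlattice socle_elem_def)

text \<open>\<epsilon> kills the line b = 0, so only the integer part of the scalar acts and the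
  line is a copy of the integers.\<close>

lemma socle_elem_smult: "dual_num a b \<odot>\<^bsub>dlattice 1 n\<^esub> socle_elem c = socle_elem (a * c)"
  by (auto simp: socle_elem_def dual_num_mult intro!: restrict_ext)

lemma socle_elem_eq_zero_iff: "socle_elem c = \<zero>\<^bsub>dlattice 1 n\<^esub> \<longleftrightarrow> c = 0"
proof
  assume "socle_elem c = \<zero>\<^bsub>dlattice 1 n\<^esub>"
  from fun_cong[OF this, of 0] show "c = 0" by (simp add: socle_elem_def dual_num_zero)
qed (auto simp: socle_elem_def dual_num_zero intro!: restrict_ext)

lemma dlattice_elem_cases:
  assumes "x \<in> carrier (dlattice 1 (\<lambda>_. n))"
  obtains a b where "x = (\<lambda>i\<in>{..<2}. if i = 0 then dual_num (n * b) a else dual_num 0 b)"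
proof -
  have x: "x \<in> {..<2} \<rightarrow>\<^sub>E carrier int_dual_numbers" and re: "re (x 1) = 0" "re (x 0) = n * im (x 1)"
    using assms by (auto simp: carrier_dlattice)
  have closed: "x 0 \<in> carrier int_dual_numbers" "x 1 \<in> carrier int_dual_numbers"
    using PiE_mem[OF x, of 0] PiE_mem[OF x, of 1] by simp_all
  then have "x 0 = dual_num (n * im (x 1)) (im (x 0))" "x 1 = dual_num 0 (im (x 1))"
    using re by (simp_all add: dual_eq_iff)
  then have "x = (\<lambda>i\<in>{..<2}. if i = 0 then dual_num (n * im (x 1)) (im (x 0)) else dual_num 0 (im (x 1)))"
    using closed by (intro PiE_ext[OF x]) (auto simp: less_2_cases_iff)
  then show thesis by (rule that)
qed

text \<open>An element (a, b) with b = 0 already lies on the line; otherwise \<epsilon> moves it to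
  (n * b, 0), which is nonzero because n is.\<close>

lemma dlattice_smult_socle:
  assumes "n \<noteq> 0" "x \<in> carrier (dlattice 1 (\<lambda>_. n))" "x \<noteq> \<zero>\<^bsub>dlattice 1 (\<lambda>_. n)\<^esub>"
  obtains r c where "r \<in> carrier int_dual_numbers" "c \<noteq> 0"
    "r \<odot>\<^bsub>dlattice 1 (\<lambda>_. n)\<^esub> x = socle_elem c"
proof -
  obtain a b where x: "x = (\<lambda>i\<in>{..<2}. if i = 0 then dual_num (n * b) a else dual_num 0 b)"
    using dlattice_elem_cases[OF assms(2)] .
  show thesis
  proof (cases "b = 0")
    case True
    then have "x = socle_elem a" by (simp add: x socle_elem_def cong: if_cong)
    moreover from this have "a \<noteq> 0" using assms(3) socle_elem_eq_zero_iff by blast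
    ultimately show thesis
      using that[of "dual_num 1 0" a] socle_elem_smult[of "\<lambda>_. n" 1 0 a] by simp
  next
    case False
    have "dual_num 0 1 \<odot>\<^bsub>dlattice 1 (\<lambda>_. n)\<^esub> x = socle_elem (n * b)"
      by (auto simp: x socle_elem_def dual_num_mult intro!: restrict_ext)
    then show thesis using that[of "dual_num 0 1" "n * b"] False assms(1) by simp
  qed
qed

lemma dlattice_indecomposable:
  assumes "n \<noteq> 0"
  shows "indecomposable_in int_dual_numbers (G_proj int_dual_numbers) (dlattice 1 (\<lambda>_. n))"
proof (rule uniform_imp_indecomposable_in)
  let ?M = "dlattice 1 (\<lambda>_. n)"
  interpret M: module int_dual_numbers ?M by (rule module_dlattice)
  show "G_proj int_dual_numbers \<subseteq> fg_modules int_dual_numbers" by (auto simp: G_proj_def)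
  show "?M \<in> G_proj int_dual_numbers" by (rule dlattice_in_G_proj)
  show "\<not> zero_module ?M"
    unfolding zero_module_def
    using socle_elem_mem[of 1 "\<lambda>_. n"] socle_elem_eq_zero_iff[of 1 "\<lambda>_. n"] by auto
  fix x y assume xy: "x \<in> carrier ?M - {\<zero>\<^bsub>?M\<^esub>}" "y \<in> carrier ?M - {\<zero>\<^bsub>?M\<^esub>}"
  obtain r c where r: "r \<in> carrier int_dual_numbers" "c \<noteq> 0" "r \<odot>\<^bsub>?M\<^esub> x = socle_elem c"
    using dlattice_smult_socle[OF assms] xy(1) by blast
  obtain s e where s: "s \<in> carrier int_dual_numbers" "e \<noteq> 0" "s \<odot>\<^bsub>?M\<^esub> y = socle_elem e"
    using dlattice_smult_socle[OF assms] xy(2) by blast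
  \<comment> \<open>Both elements have been moved to nonzero integers c and e on the line, where e *
    c is a common nonzero multiple.\<close>
  have "(dual_num e 0 \<otimes>\<^bsub>int_dual_numbers\<^esub> r) \<odot>\<^bsub>?M\<^esub> x = socle_elem (e * c)"
    using M.smult_assoc1[of "dual_num e 0" r x] r xy(1) socle_elem_smult[of "\<lambda>_. n" e 0 c]
    by (simp del: dlattice_simps)
  moreover have "(dual_num c 0 \<otimes>\<^bsub>int_dual_numbers\<^esub> s) \<odot>\<^bsub>?M\<^esub> y = socle_elem (e * c)"
    using M.smult_assoc1[of "dual_num c 0" s y] s xy(2) socle_elem_smult[of "\<lambda>_. n" c 0 e]
    by (simp del: dlattice_simps add: mult.commute)
  moreover have "socle_elem (e * c) \<noteq> \<zero>\<^bsub>?M\<^esub>" using socle_elem_eq_zero_iff[of "e * c" "\<lambda>_. n"] r s by auto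
  ultimately show "\<exists>r\<in>carrier int_dual_numbers. \<exists>s\<in>carrier int_dual_numbers.
      r \<odot>\<^bsub>?M\<^esub> x = s \<odot>\<^bsub>?M\<^esub> y \<and> r \<odot>\<^bsub>?M\<^esub> x \<noteq> \<zero>\<^bsub>?M\<^esub>"
    using r(1) s(1) by (metis dual.m_closed dual_num_closed)
qed

text \<open>An isomorphism would carry the equality of kernel and image of \<epsilon> from
  \<open>L\<^sub>1\<close> to \<open>L\<^sub>n\<close>. In \<open>L\<^sub>n\<close> the vector (1,
  0) is killed by \<epsilon>, but the image of \<epsilon> consists of the vectors (n * q,
  0).\<close>

lemma dlattice_1_not_iso:
  assumes "\<not> n dvd 1"
  shows "\<not> mod_iso int_dual_numbers (dlattice 1 (\<lambda>_. 1)) (dlattice 1 (\<lambda>_. n))"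
proof
  let ?M = "dlattice 1 (\<lambda>_. 1)" and ?N = "dlattice 1 (\<lambda>_. n)" and ?e = "dual_num 0 1"
  interpret M: module int_dual_numbers ?M by (rule module_dlattice)
  interpret N: module int_dual_numbers ?N by (rule module_dlattice)
  assume "mod_iso int_dual_numbers ?M ?N"
  then obtain f where f: "f \<in> mod_hom int_dual_numbers ?M ?N" and bij: "bij_betw f (carrier ?M) (carrier ?N)"
    unfolding mod_iso_def by blast
  have "socle_elem 1 \<in> f ` carrier ?M"
    using socle_elem_mem bij_betw_imp_surj_on[OF bij] by blast
  then obtain x where x: "x \<in> carrier ?M" "f x = socle_elem 1" by auto
  have "f (?e \<odot>\<^bsub>?M\<^esub> x) = ?e \<odot>\<^bsub>?N\<^esub> socle_elem 1"
    using mod_hom_smult[OF f dual_num_closed x(1)] x(2) by simp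
  also have "\<dots> = \<zero>\<^bsub>?N\<^esub>"
    unfolding socle_elem_smult using socle_elem_eq_zero_iff[of 0 "\<lambda>_. n"] by simp
  also have "\<dots> = f \<zero>\<^bsub>?M\<^esub>"
    using mod_hom_zero[OF M.module_axioms N.module_axioms f] by simp
  finally have ex: "?e \<odot>\<^bsub>?M\<^esub> x = \<zero>\<^bsub>?M\<^esub>"
    using bij M.smult_closed[OF dual_num_closed x(1)] M.M.zero_closed
    by (auto simp: bij_betw_def simp del: dlattice_simps dest: inj_onD)
  obtain a b where ab: "x = (\<lambda>i\<in>{..<2}. if i = 0 then dual_num (1 * b) a else dual_num 0 b)"
    using dlattice_elem_cases[OF x(1)] .
  have "b = 0"
    using fun_cong[OF ex, of 0] by (simp add: ab dual_num_mult dual_num_zero)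
  \<comment> \<open>This is (0, a) in \<open>L\<^sub>1\<close>, whose multiple by \<epsilon> is (a,
    0), that is, \<open>x\<close>.\<close>
  define z where "z = (\<lambda>i\<in>{..<2 :: nat}. if i = 0 then dual_num a 0 else dual_num 0 a)"
  have z: "z \<in> carrier ?M" by (simp add: z_def carrier_dlattice)
  have "x = ?e \<odot>\<^bsub>?M\<^esub> z"
    using \<open>b = 0\<close> by (auto simp: ab z_def dual_num_mult intro!: restrict_ext)
  then have "socle_elem 1 = ?e \<odot>\<^bsub>?N\<^esub> f z"
    using mod_hom_smult[OF f dual_num_closed z] x(2) by simp
  moreover obtain p q where "f z = (\<lambda>i\<in>{..<2}. if i = 0 then dual_num (n * q) p else dual_num 0 q)"
    using dlattice_elem_cases[OF mod_hom_closed[OF f z]] .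
  ultimately have "socle_elem 1 0 = dual_num 0 (n * q)"
    by (simp add: dual_num_mult)
  then have "n * q = 1" by (simp add: socle_elem_def)
  then show False using assms by (metis dvd_triv_left)
qed

text \<open>The kernel conditions involve one block at a time, so cutting a vector into its blocks
  is an isomorphism: index 2 i + l corresponds to block i, position l.\<close>

lemma dlattice_iso_direct_sum:
  "mod_iso int_dual_numbers (dlattice k n) (direct_sum {..<k} (\<lambda>i. dlattice 1 (\<lambda>_. n i)))"
proof (rule mod_isoI)
  let ?M = "dlattice k n" and ?N = "direct_sum {..<k} (\<lambda>i. dlattice 1 (\<lambda>_. n i))"
  let ?f = "\<lambda>x\<in>carrier ?M. \<lambda>i\<in>{..<k}. \<lambda>l\<in>{..<2}. x (2 * i + l)"
  let ?g = "\<lambda>y. \<lambda>j\<in>{..<2 * k}. y (j div 2) (j mod 2)"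
  interpret M: module int_dual_numbers ?M by (rule module_dlattice)
  have idx: "2 * i + l < 2 * k" if "i < k" "l < 2" for i l :: nat using that by simp
  show "?f \<in> mod_hom int_dual_numbers ?M ?N"
  proof (rule mod_homI)
    fix x assume x: "x \<in> carrier ?M"
    then have "x j \<in> carrier int_dual_numbers" if "j < 2 * k" for j
      using that by (auto simp: carrier_dlattice intro: dual_free_mem)
    then show "?f x \<in> carrier ?N"
      using x by (auto simp: carrier_dlattice idx)
  next
    fix x y assume "x \<in> carrier ?M" "y \<in> carrier ?M"
    with M.M.a_closed[OF this] show "?f (x \<oplus>\<^bsub>?M\<^esub> y) = ?f x \<oplus>\<^bsub>?N\<^esub> ?f y"
      by (auto simp: idx intro!: restrict_ext)
  next
    fix r x assume "r \<in> carrier int_dual_numbers" "x \<in> carrier ?M"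
    with M.smult_closed[OF this] show "?f (r \<odot>\<^bsub>?M\<^esub> x) = r \<odot>\<^bsub>?N\<^esub> ?f x"
      by (auto simp: idx intro!: restrict_ext)
  qed simp
  have g: "?g y \<in> carrier ?M" if y: "y \<in> carrier ?N" for y
  proof -
    have yi: "y i \<in> carrier (dlattice 1 (\<lambda>_. n i))" if "i < k" for i
      using y that by auto
    have "y i l \<in> carrier int_dual_numbers" if "i < k" "l < 2" for i l
      using yi[OF that(1)] that(2) by (auto simp: carrier_dlattice)
    then show ?thesis using yi by (auto simp: carrier_dlattice)
  qed
  then show "\<And>y. y \<in> carrier ?N \<Longrightarrow> ?g y \<in> carrier ?M" .
  show "?g (?f x) = x" if x: "x \<in> carrier ?M" for x
  proof -
    have "x \<in> {..<2 * k} \<rightarrow>\<^sub>E carrier int_dual_numbers" using x by (simp add: carrier_dlattice)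
    then show ?thesis using x by (intro PiE_ext[OF _ \<open>x \<in> _ \<rightarrow>\<^sub>E _\<close>]) (auto simp: dual_free_mem)
  qed
  show "?f (?g y) = y" if y: "y \<in> carrier ?N" for y
  proof
    fix i
    show "?f (?g y) i = y i"
    proof (cases "i < k")
      case True
      then have "y i \<in> {..<2} \<rightarrow>\<^sub>E carrier int_dual_numbers"
        using y by (auto simp: carrier_dlattice)
      then have "y i = (\<lambda>l\<in>{..<2}. y i l)" by (simp add: PiE_restrict)
      moreover have "?f (?g y) i = (\<lambda>l\<in>{..<2}. y i l)"
        using g[OF y] True by (auto simp: idx intro!: restrict_ext)
      ultimately show ?thesis by simp
    next
      case False
      \<comment> \<open>Beyond the last block both sides take the default value of extensional
        functions.\<close>
      then have "y i = undefined" by (intro PiE_arb[OF y[unfolded direct_sum_simps]]) simp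
      then show ?thesis using g[OF y] False by simp
    qed
  qed
qed

text \<open>With \<open>U = [[2, 1], [3, 2]]\<close> and \<open>V = [[1, 3], [1, 4]]\<close>, both of determinant 1, one has
  \<open>U diag(1, 6) = diag(2, 3) V\<close>; the isomorphism applies \<open>U\<close> to the even and \<open>V\<close> to the odd coordinates.\<close>

lemma dlattice_1_6_iso_2_3:
  "mod_iso int_dual_numbers (dlattice 2 (\<lambda>i. if i = 0 then 1 else 6)) (dlattice 2 (\<lambda>i. if i = 0 then 2 else 3))"
proof (rule mod_isoI)
  let ?M = "dlattice 2 (\<lambda>i. if i = 0 then 1 else 6)" and ?N = "dlattice 2 (\<lambda>i. if i = 0 then 2 else 3)"
  let ?lin = "\<lambda>a x b y. dual_num a 0 \<otimes>\<^bsub>int_dual_numbers\<^esub> x \<oplus>\<^bsub>int_dual_numbers\<^esub> dual_num b 0 \<otimes>\<^bsub>int_dual_numbers\<^esub> y"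
  let ?F = "\<lambda>x. \<lambda>i\<in>{..<4 :: nat}. if i = 0 then ?lin 2 (x 0) 1 (x 2) else if i = 1 then ?lin 1 (x 1) 3 (x 3)
    else if i = 2 then ?lin 3 (x 0) 2 (x 2) else ?lin 1 (x 1) 4 (x 3)"
  let ?f = "\<lambda>x\<in>carrier ?M. ?F x"
  \<comment> \<open>The inverse matrices: [[2, -1], [-3, 2]] on the even and [[4, -3], [-1, 1]] on
    the odd coordinates.\<close>
  let ?g = "\<lambda>x. \<lambda>i\<in>{..<4 :: nat}. if i = 0 then ?lin 2 (x 0) (- 1) (x 2) else if i = 1 then ?lin 4 (x 1) (- 3) (x 3)
    else if i = 2 then ?lin (- 3) (x 0) 2 (x 2) else ?lin (- 1) (x 1) 1 (x 3)"
  interpret M: module int_dual_numbers ?M by (rule module_dlattice)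
  have less_4: "i < 4 \<longleftrightarrow> i = 0 \<or> i = 1 \<or> i = 2 \<or> i = 3" for i :: nat by auto
  have all_less_2: "(\<forall>j<2. Q j) \<longleftrightarrow> Q 0 \<and> Q 1" for Q :: "nat \<Rightarrow> bool"
    by (auto simp: less_2_cases_iff)
  have mem_iff: "x \<in> carrier (dlattice 2 n) \<longleftrightarrow> x \<in> {..<4} \<rightarrow>\<^sub>E carrier int_dual_numbers \<and>
      re (x 1) = 0 \<and> re (x 0) = n 0 * im (x 1) \<and> re (x 3) = 0 \<and> re (x 2) = n 1 * im (x 3)" for x n
    unfolding carrier_dlattice all_less_2 by simp
  have mem: "x i \<in> carrier int_dual_numbers" if "x \<in> carrier (dlattice 2 n)" "i < 4" for x n i
    using that by (auto simp: carrier_dlattice)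
  have closed: "x 0 \<in> carrier int_dual_numbers" "x (Suc 0) \<in> carrier int_dual_numbers"
    "x 2 \<in> carrier int_dual_numbers" "x 3 \<in> carrier int_dual_numbers"
    if "x \<in> carrier (dlattice 2 n)" for x n
    using mem[OF that] by simp_all
  \<comment> \<open>Membership means that the real parts at even places are the diagonal matrix
    times the imaginary parts at odd places. This is preserved because
    \<open>U diag(1, 6) = diag(2, 3) V\<close>, and in the other direction by the inverse
    relation.\<close>
  have F: "?F x \<in> carrier ?N" if x: "x \<in> carrier ?M" for x
    using x closed[OF x] by (simp add: mem_iff)
  show g: "?g y \<in> carrier ?M" if y: "y \<in> carrier ?N" for y
    using y closed[OF y] by (simp add: mem_iff)
  show "?f \<in> mod_hom int_dual_numbers ?M ?N"
  proof (rule mod_homI)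
    show "?f x \<in> carrier ?N" if x: "x \<in> carrier ?M" for x
      using F[OF x] x by simp
  next
    fix x y assume x: "x \<in> carrier ?M" and y: "y \<in> carrier ?M"
    have "?F (x \<oplus>\<^bsub>?M\<^esub> y) = ?F x \<oplus>\<^bsub>?N\<^esub> ?F y"
      using closed[OF x] closed[OF y] by (simp add: fun_eq_iff dual_eq_iff algebra_simps)
    then show "?f (x \<oplus>\<^bsub>?M\<^esub> y) = ?f x \<oplus>\<^bsub>?N\<^esub> ?f y"
      using x y M.M.a_closed[OF x y] by (simp del: dlattice_simps)
  next
    fix r x assume r: "r \<in> carrier int_dual_numbers" and x: "x \<in> carrier ?M"
    have "?F (r \<odot>\<^bsub>?M\<^esub> x) = r \<odot>\<^bsub>?N\<^esub> ?F x"
      using closed[OF x] r by (simp add: fun_eq_iff dual_eq_iff algebra_simps)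
    then show "?f (r \<odot>\<^bsub>?M\<^esub> x) = r \<odot>\<^bsub>?N\<^esub> ?f x"
      using x M.smult_closed[OF r x] by (simp del: dlattice_simps)
  qed simp
  show "?g (?f x) = x" if x: "x \<in> carrier ?M" for x
  proof -
    have mem: "x \<in> {..<4} \<rightarrow>\<^sub>E carrier int_dual_numbers" using x by (simp add: carrier_dlattice)
    have mem': "?g (?F x) \<in> {..<4} \<rightarrow>\<^sub>E carrier int_dual_numbers"
      using g[OF F[OF x]] by (simp add: carrier_dlattice)
    have eq: "?g (?F x) i = x i" if "i \<in> {..<4}" for i
      using that closed[OF x] unfolding lessThan_iff less_4
      by (elim disjE) (simp_all add: dual_eq_iff algebra_simps)
    have "?g (?F x) = x" by (intro PiE_ext[OF mem' mem] eq)
    then show ?thesis unfolding restrict_apply'[OF x] .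
  qed
  show "?f (?g y) = y" if y: "y \<in> carrier ?N" for y
  proof -
    have mem: "y \<in> {..<4} \<rightarrow>\<^sub>E carrier int_dual_numbers" using y by (simp add: carrier_dlattice)
    have mem': "?F (?g y) \<in> {..<4} \<rightarrow>\<^sub>E carrier int_dual_numbers"
      using F[OF g[OF y]] by (simp add: carrier_dlattice)
    have eq: "?F (?g y) i = y i" if "i \<in> {..<4}" for i
      using that closed[OF y] unfolding lessThan_iff less_4
      by (elim disjE) (simp_all add: dual_eq_iff algebra_simps)
    have "?F (?g y) = y" by (intro PiE_ext[OF mem' mem] eq)
    then show ?thesis unfolding restrict_apply'[OF g[OF y]] .
  qed
qed

theorem lemma3p2p3:
  "\<exists>M\<in>G_proj int_dual_numbers. \<exists>m n X Y.
     (\<forall>i<m. indecomposable_in int_dual_numbers (G_proj int_dual_numbers) (X i)) \<and>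
     (\<forall>i<n. indecomposable_in int_dual_numbers (G_proj int_dual_numbers) (Y i)) \<and>
     mod_iso int_dual_numbers M (direct_sum {..<m :: nat} X) \<and>
     mod_iso int_dual_numbers M (direct_sum {..<n :: nat} Y) \<and>
     \<not> (\<exists>\<sigma>. bij_betw \<sigma> {..<m} {..<n} \<and> (\<forall>i<m. mod_iso int_dual_numbers (X i) (Y (\<sigma> i))))"
proof -
  let ?R = int_dual_numbers
  let ?a = "\<lambda>i :: nat. if i = 0 then 1 else 6 :: int" and ?b = "\<lambda>i :: nat. if i = 0 then 2 else 3 :: int"
  define X where "X i = dlattice 1 (\<lambda>_. ?a i)" for i
  define Y where "Y i = dlattice 1 (\<lambda>_. ?b i)" for i
  have sum_X: "mod_iso ?R (dlattice 2 ?a) (direct_sum {..<2} X)"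
    unfolding X_def by (rule dlattice_iso_direct_sum)
  have "mod_iso ?R (dlattice 2 ?b) (direct_sum {..<2} Y)"
    unfolding Y_def by (rule dlattice_iso_direct_sum)
  then have sum_Y: "mod_iso ?R (dlattice 2 ?a) (direct_sum {..<2} Y)"
    by (rule mod_iso_trans[OF module_dlattice dlattice_1_6_iso_2_3])
  have ind_X: "indecomposable_in ?R (G_proj ?R) (X i)" for i
    unfolding X_def by (rule dlattice_indecomposable) simp
  have ind_Y: "indecomposable_in ?R (G_proj ?R) (Y i)" for i
    unfolding Y_def by (rule dlattice_indecomposable) simp
  \<comment> \<open>Every \<open>?b j\<close> is 2 or 3 and does not divide 1. So the summand at
    index 0 has no partner, and no bijection can match the two families although both have two
    members.\<close>
  have "\<not> mod_iso ?R (X 0) (Y j)" for j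
    using dlattice_1_not_iso[of "?b j"] by (simp add: X_def Y_def)
  then have not_iso: "\<not> (\<exists>\<sigma>. bij_betw \<sigma> {..<2 :: nat} {..<2 :: nat} \<and> (\<forall>i<2. mod_iso ?R (X i) (Y (\<sigma> i))))"
    using zero_less_numeral by blast
  show ?thesis
    by (rule bexI[OF _ dlattice_in_G_proj[of 2 ?a]], rule exI[of _ 2], rule exI[of _ 2],
        rule exI[of _ X], rule exI[of _ Y])
      (intro conjI allI impI ind_X ind_Y sum_X sum_Y not_iso)
qed

end
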